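(* Let $M\in\mathrm{M}_n(\mathbb{K})$ be a cyclic matrix with minimal polynomial $f=f_1^{m_1}\cdots f_s^{m_s}$, where $f_1,\dots,f_s\in\mathbb{K}[x]$ are pairwise distinct monic irreducible separable polynomials and $m_i\ge1$. For $P\in\mathbb{L}[x]$ let $\delta_{\mathbb{L}}(P)$ be the number of monic irreducible divisors of $P$ in $\mathbb{L}[x]$. Let $\mathbb{P}$ be the proportion, among all $M$-cyclic codes $\mathcal{C}\subseteq\mathbb{L}^n$ (including $\{0\}$ and $\mathbb{L}^n$), of those with minimal rank distance different from $1$ (i.e. $\mathcal{C}=\{0\}$ or $M_1(\mathcal{C})\ge2$). Then $$\mathbb{P}=\prod_{i=1}^s\Big(1-\Big(\frac{m_i}{m_i+1}\Big)^{\delta_{\mathbb{L}}(f_i)}\Big),\qquad \prod_{i=1}^s\frac{1}{m_i+1}\le\mathbb{P}\le\prod_{i=1}^s\Big(1-\Big(\frac{m_i}{m_i+1}\Big)^{\deg f_i}\Big).$$ Moreover: (1) $\mathbb{P}=\prod_i\frac1{m_i+1}$ if and only if $f_1,\dots,f_s$ are irreducible in $\mathbb{L}[x]$, if and only if every nonzero $M$-cyclic code has first rank weight $1$; (2) $\mathbb{P}=\prod_i\big(1-(\frac{m_i}{m_i+1})^{\deg f_i}\big)$ if and only if $f$ splits completely into linear factors in $\mathbb{L}[x]$.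
   Context: Let $\mathbb{L}/\mathbb{K}$ be a field extension of finite degree $m\ge n$. Vectors are row vectors. For $c=(c_1,\dots,c_n)\in\mathbb{L}^n$, $\mathrm{wt}_R(c)=\dim_{\mathbb{K}}\mathrm{Span}_{\mathbb{K}}(c_1,\dots,c_n)$, and for a nonzero linear code $\mathcal{C}\subseteq\mathbb{L}^n$ (an $\mathbb{L}$-subspace), $M_1(\mathcal{C})=\min\{\mathrm{wt}_R(c):0\neq c\in\mathcal{C}\}$. A matrix $M\in\mathrm{M}_n(\mathbb{K})$ is cyclic if there is $v\in\mathbb{K}^n$ with $(v,vM^t,\dots,v(M^t)^{n-1})$ a basis of $\mathbb{K}^n$. An $M$-cyclic code is an $\mathbb{L}$-subspace $\mathcal{C}\subseteq\mathbb{L}^n$ with $cM^t\in\mathcal{C}$ for all $c\in\mathcal{C}$, where $M$ is cyclic; these are in bijection with the monic divisors of $f$ in $\mathbb{L}[x]$. *)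

theory Defs
  imports "HOL-Analysis.Analysis" "HOL-Computational_Algebra.Polynomial"
begin

text \<open>A field extension L/K is given by a ring homomorphism emb from the field 'k
  into the field 'l (automatically injective). L is a K-vector space via this scalar action.\<close>

definition ext_scale :: "('k::field \<Rightarrow> 'l::field) \<Rightarrow> 'k \<Rightarrow> 'l \<Rightarrow> 'l" where
  "ext_scale emb a x = emb a * x"

definition is_field_ext :: "('k::field \<Rightarrow> 'l::field) \<Rightarrow> bool" where
  "is_field_ext emb \<longleftrightarrow> emb 1 = 1 \<and> (\<forall>a b. emb (a + b) = emb a + emb b)
     \<and> (\<forall>a b. emb (a * b) = emb a * emb b)"

text \<open>The extension has finite degree d: L has a finite K-basis of cardinality d.\<close>
definition ext_degree_is :: "('k::field \<Rightarrow> 'l::field) \<Rightarrow> nat \<Rightarrow> bool" where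
  "ext_degree_is emb d \<longleftrightarrow> (\<exists>B. finite B \<and> card B = d
      \<and> module.independent (ext_scale emb) B \<and> module.span (ext_scale emb) B = UNIV)"

text \<open>Rank weight: K-dimension of the K-span of the entries of c.\<close>
definition rank_wt :: "('k::field \<Rightarrow> 'l::field) \<Rightarrow> 'l ^ 'n \<Rightarrow> nat" where
  "rank_wt emb c = vector_space.dim (ext_scale emb) (module.span (ext_scale emb) (range (\<lambda>i. c $ i)))"

text \<open>First rank weight M_1 of a code (meaningful for nonzero codes).\<close>
definition M1 :: "('k::field \<Rightarrow> 'l::field) \<Rightarrow> ('l ^ 'n) set \<Rightarrow> nat" where
  "M1 emb C = Min {rank_wt emb c | c. c \<in> C \<and> c \<noteq> 0}"

text \<open>Evaluation of a polynomial at a square matrix.\<close>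
definition poly_mat :: "'a::field poly \<Rightarrow> 'a ^ 'n ^ 'n \<Rightarrow> 'a ^ 'n ^ 'n" where
  "poly_mat p A = (\<chi> r s. \<Sum>i\<le>degree p. coeff p i * (((**) A ^^ i) (mat 1)) $ r $ s)"

text \<open>f is the minimal polynomial of A: the monic generator of the annihilator ideal.\<close>
definition is_min_poly :: "'a::field ^ 'n ^ 'n \<Rightarrow> 'a poly \<Rightarrow> bool" where
  "is_min_poly A f \<longleftrightarrow> lead_coeff f = 1 \<and> poly_mat f A = 0 \<and> (\<forall>g. poly_mat g A = 0 \<longrightarrow> f dvd g)"

text \<open>Cyclic matrix: some v such that (v, A v, ..., A^(n-1) v) is a basis of K^n
  (row-vector convention v M^t corresponds to M *v v).\<close>
definition cyclic_matrix :: "'a::field ^ 'n ^ 'n \<Rightarrow> bool" where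
  "cyclic_matrix A \<longleftrightarrow> (\<exists>v. let vs = (\<lambda>k. (((*v) A) ^^ k) v) in
     inj_on vs {..<CARD('n)} \<and> vec.independent (vs ` {..<CARD('n)})
     \<and> vec.span (vs ` {..<CARD('n)}) = UNIV)"

text \<open>Separable polynomial: coprime to its formal derivative.\<close>
definition separable_poly :: "'a::field poly \<Rightarrow> bool" where
  "separable_poly p \<longleftrightarrow> coprime p (pderiv p)"

text \<open>The matrix M seen over L.\<close>
definition map_mat :: "('k \<Rightarrow> 'l) \<Rightarrow> 'k ^ 'n ^ 'm \<Rightarrow> 'l ^ 'n ^ 'm" where
  "map_mat emb A = (\<chi> i j. emb (A $ i $ j))"

text \<open>M-cyclic codes: L-subspaces of L^n stable under c \<mapsto> c M^t.\<close>
definition cyclic_codes :: "('k::field \<Rightarrow> 'l::field) \<Rightarrow> 'k ^ 'n ^ 'n \<Rightarrow> ('l ^ 'n) set set" where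
  "cyclic_codes emb A = {C. vec.subspace C \<and> (\<forall>c\<in>C. map_mat emb A *v c \<in> C)}"

text \<open>Number of monic irreducible divisors.\<close>
definition delta :: "'a::field poly \<Rightarrow> nat" where
  "delta P = card {g. lead_coeff g = 1 \<and> irreducible g \<and> g dvd P}"

text \<open>P splits completely into linear factors.\<close>
definition splits :: "'a::field poly \<Rightarrow> bool" where
  "splits P \<longleftrightarrow> (\<exists>c rs. P = smult c (prod_list (map (\<lambda>r. [:-r, 1:]) rs)))"

end

theory Submission
  imports Defs "HOL-Computational_Algebra.Polynomial_Factorial"
begin

text \<open>
  Let \<open>v\<close> be a cyclic vector of \<open>M\<close>. The map \<open>p \<mapsto> p(M) v\<close> identifies \<open>L[x]/(f)\<close> with \<open>L\<^sup>n\<close>, the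
  subring \<open>K[x]/(f)\<close> with \<open>K\<^sup>n\<close>, and \<open>M\<close>-cyclic codes with the ideals \<open>(g)\<close>, \<open>g\<close> a monic divisor of
  \<open>f\<close> in \<open>L[x]\<close>. A word of rank weight one is an \<open>L\<close>-multiple of a nonzero vector of \<open>K\<^sup>n\<close>, so the
  code of \<open>g\<close> has minimal rank distance one iff \<open>g\<close> divides some \<open>h \<in> K[x]\<close> with \<open>\<not> f dvd h\<close>. Passing
  to the gcd of \<open>h\<close> and \<open>f\<close> in \<open>K[x]\<close>, this means that \<open>g\<close> divides \<open>f / f\<^sub>i\<close> for some \<open>i\<close>. By
  separability each \<open>f\<^sub>i\<close> is a product of \<open>\<delta>\<^sub>i\<close> distinct primes over \<open>L\<close>, and these primes differ for
  different \<open>i\<close>. In terms of the exponents of \<open>g\<close>, which range over \<open>0, \<dots>, m\<^sub>i\<close>, the code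
  does not have minimal rank distance one iff for every \<open>i\<close> some prime dividing \<open>f\<^sub>i\<close> has exponent
  \<open>m\<^sub>i\<close>; there are \<open>(m\<^sub>i + 1)\<^bsup>\<delta>\<^sub>i\<^esup> - m\<^sub>i\<^bsup>\<delta>\<^sub>i\<^esup>\<close> choices for each \<open>i\<close>. The remaining claims follow since
  \<open>1 - (m / (m + 1))\<^bsup>\<delta>\<^esup>\<close> is strictly increasing in \<open>\<delta>\<close> and \<open>1 \<le> \<delta>\<^sub>i \<le> deg f\<^sub>i\<close>.
\<close>

section \<open>Monic divisors of polynomials over a field\<close>

lemma monic_dvd_antisym:
  fixes p q :: "'a::field poly"
  assumes "lead_coeff p = 1" "lead_coeff q = 1" "p dvd q" "q dvd p"
  shows "p = q"
proof -
  obtain r where r: "q = p * r" using assms(3) by blast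
  have nz: "p \<noteq> 0" "q \<noteq> 0" using assms by auto
  then have "degree r = 0"
    using r dvd_imp_degree_le[OF assms(4)] by (auto simp: degree_mult_eq)
  moreover have "lead_coeff r = 1" using assms r by (simp add: lead_coeff_mult)
  ultimately have "r = 1" by (auto elim!: degree_eq_zeroE)
  then show ?thesis using r by simp
qed

lemma monic_dvd_irreducible_eq:
  fixes p q :: "'a::field poly"
  assumes "lead_coeff p = 1" "lead_coeff q = 1" "irreducible p" "irreducible q" "p dvd q"
  shows "p = q"
proof -
  have "\<not> p dvd 1" using assms by (auto simp: irreducible_def)
  with assms(4,5) have "q dvd p" by (auto dest: irreducibleD')
  with assms show ?thesis by (blast intro: monic_dvd_antisym)
qed

lemma monic_dvd_one:
  fixes p :: "'a::field poly"
  assumes "lead_coeff p = 1" "p dvd 1"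
  shows "p = 1"
  using assms by (simp add: monic_dvd_antisym)

text \<open>Division with remainder by an element of least degree. It is applied to ideals generated
  by two polynomials, to annihilators of a vector, to preimages of codes and to contractions of
  ideals from L[x] to K[x].\<close>

lemma field_poly_ideal_principal:
  fixes J :: "'a::field poly set"
  assumes nz: "\<exists>p\<in>J. p \<noteq> 0"
    and add: "\<And>p q. p \<in> J \<Longrightarrow> q \<in> J \<Longrightarrow> p + q \<in> J"
    and mult: "\<And>p q. p \<in> J \<Longrightarrow> q * p \<in> J"
  obtains g where "lead_coeff g = 1" "J = {p. g dvd p}"
proof -
  obtain p0 where p0: "p0 \<in> J" "p0 \<noteq> 0" using nz by blast
  define h where "h = (ARG_MIN degree p. p \<in> J \<and> p \<noteq> 0)"
  have h: "h \<in> J" "h \<noteq> 0" and hmin: "\<And>p. p \<in> J \<Longrightarrow> p \<noteq> 0 \<Longrightarrow> degree h \<le> degree p"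
    using arg_min_nat_lemma[of "\<lambda>p. p \<in> J \<and> p \<noteq> 0" p0 degree] p0 unfolding h_def by auto
  define g where "g = smult (inverse (lead_coeff h)) h"
  have g: "lead_coeff g = 1" using h by (simp add: g_def)
  have dvd_iff: "g dvd p \<longleftrightarrow> h dvd p" for p
    using h by (simp add: g_def smult_dvd_iff)
  have "h dvd p" if "p \<in> J" for p
  proof (rule ccontr)
    assume n: "\<not> h dvd p"
    have "p mod h = p + (- (p div h)) * h"
      by (simp add: minus_div_mult_eq_mod)
    then have "p mod h \<in> J" using add mult that h by metis
    moreover have "p mod h \<noteq> 0" using n by (simp add: dvd_eq_mod_eq_0)
    ultimately show False using hmin[of "p mod h"] degree_mod_less[of h p] h by auto
  qed
  moreover have "p \<in> J" if "h dvd p" for p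
    using that mult h by (metis dvdE mult.commute)
  ultimately have "J = {p. g dvd p}" by (auto simp: dvd_iff)
  with g that show ?thesis by blast
qed

text \<open>The generator of the ideal spanned by \<open>p\<close> and \<open>q\<close> divides
  both, so it is a unit. An identity of this kind is carried along a field embedding, which
  transfers coprimality from K[x] to L[x].\<close>

lemma field_poly_bezout:
  fixes p q :: "'a::field poly"
  assumes "p \<noteq> 0" and cop: "\<And>c. c dvd p \<Longrightarrow> c dvd q \<Longrightarrow> is_unit c"
  obtains a b where "a * p + b * q = 1"
proof -
  let ?J = "{a * p + b * q | a b. True}"
  have "p = 1 * p + 0 * q" "q = 0 * p + 1 * q" by simp_all
  then have pq: "p \<in> ?J" "q \<in> ?J" by blast+
  obtain g where g: "?J = {r. g dvd r}"
  proof (rule field_poly_ideal_principal[of ?J])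
    show "\<exists>p\<in>?J. p \<noteq> 0" using pq assms(1) by blast
    fix u v assume "u \<in> ?J" "v \<in> ?J"
    then obtain a b a' b' where "u = a * p + b * q" "v = a' * p + b' * q" by blast
    then have "u + v = (a + a') * p + (b + b') * q" by (simp add: algebra_simps)
    then show "u + v \<in> ?J" by blast
  next
    fix u v assume "u \<in> ?J"
    then obtain a b where "u = a * p + b * q" by blast
    then have "v * u = (v * a) * p + (v * b) * q" by (simp add: algebra_simps)
    then show "v * u \<in> ?J" by blast
  qed
  have "g dvd p" "g dvd q" using pq g by blast+
  then have "is_unit g" by (rule cop)
  then have "1 \<in> ?J" using g by blast
  then show ?thesis using that by auto
qed

lemma field_poly_irreducible_bezout:
  fixes p q :: "'a::field poly"
  assumes "irreducible p" "\<not> p dvd q"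
  obtains a b where "a * p + b * q = 1"
proof (rule field_poly_bezout)
  show "p \<noteq> 0" using assms by auto
  show "is_unit c" if "c dvd p" "c dvd q" for c
    using that assms irreducibleD' dvd_trans by blast
qed

text \<open>A nonunit divisor of least degree is irreducible, since a proper factorization would
  contain a nonunit divisor of smaller degree. Scaling makes it monic.\<close>

lemma monic_irreducible_factor_exists:
  fixes p :: "'a::field poly"
  assumes "p \<noteq> 0" "\<not> is_unit p"
  obtains q where "lead_coeff q = 1" "irreducible q" "q dvd p"
proof -
  let ?P = "\<lambda>h. h dvd p \<and> \<not> is_unit h"
  define h where "h = (ARG_MIN degree h. ?P h)"
  have h: "h dvd p" "\<not> is_unit h" and hmin: "\<And>q. ?P q \<Longrightarrow> degree h \<le> degree q"
    using arg_min_nat_lemma[of ?P p degree] assms unfolding h_def by auto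
  have h0: "h \<noteq> 0" using h assms by auto
  have irr: "irreducible h"
  proof (rule irreducibleI)
    fix a b assume ab: "h = a * b"
    with h0 have "a \<noteq> 0" "b \<noteq> 0" by auto
    show "is_unit a \<or> is_unit b"
    proof (rule ccontr)
      assume "\<not> (is_unit a \<or> is_unit b)"
      then have na: "\<not> is_unit a" and nb: "\<not> is_unit b" by auto
      have "a dvd p" using h ab by (metis dvd_mult_left)
      then have "degree h \<le> degree a" using na hmin by blast
      moreover have "degree b > 0" using nb \<open>b \<noteq> 0\<close> by (simp add: is_unit_iff_degree)
      ultimately show False
        using ab \<open>a \<noteq> 0\<close> \<open>b \<noteq> 0\<close> by (simp add: degree_mult_eq)
    qed
  qed (use h h0 in auto)
  define g where "g = smult (inverse (lead_coeff h)) h"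
  have "lead_coeff g = 1" using h0 by (simp add: g_def)
  moreover have "g dvd p" using h h0 by (simp add: g_def smult_dvd_iff)
  moreover have "irreducible g"
  proof -
    have u: "is_unit [:inverse (lead_coeff h):]" using h0 by (simp add: is_unit_const_poly_iff dvd_field_iff)
    have "g = [:inverse (lead_coeff h):] * h" by (simp add: g_def)
    then show ?thesis using irr u irreducible_mult_unit_left by metis
  qed
  ultimately show ?thesis using that by blast
qed

section \<open>Divisors of a product of powers of distinct monic primes\<close>

lemma prime_elem_dvd_prodE:
  assumes "prime_elem p" "finite A" "p dvd prod g A"
  obtains a where "a \<in> A" "p dvd g a"
proof -
  have "\<exists>a\<in>A. p dvd g a"
    using assms(2,3)
  proof (induction rule: finite_induct)
    case empty
    then show ?case using assms(1) by (simp add: prime_elem_not_unit)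
  next
    case (insert x F)
    then show ?case using prime_elem_dvd_multD[OF assms(1), of "g x" "prod g F"] by auto
  qed
  then show ?thesis using that by blast
qed

lemma monic_irreducible_dvd_prod_power:
  fixes T :: "'a::field poly set"
  assumes fin: "finite T" and T: "\<And>q. q \<in> T \<Longrightarrow> lead_coeff q = 1 \<and> irreducible q"
    and q: "lead_coeff q = 1" "irreducible q" and dvd: "q dvd (\<Prod>p\<in>T. p ^ e p)"
  shows "q \<in> T \<and> e q > 0"
proof -
  have pr: "prime_elem q" using q by (simp add: field_poly_irreducible_imp_prime)
  obtain p where p: "p \<in> T" "q dvd p ^ e p"
    using prime_elem_dvd_prodE[OF pr fin dvd] by blast
  have "e p > 0" using p pr by (cases "e p") (auto simp: prime_elem_def)
  moreover have "q dvd p" using p pr by (metis prime_elem_dvd_power)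
  then have "q = p" using monic_dvd_irreducible_eq T p q by blast
  ultimately show ?thesis using p by simp
qed

lemma prod_power_dvd_iff:
  fixes T :: "'a::field poly set"
  assumes fin: "finite T" and T: "\<And>q. q \<in> T \<Longrightarrow> lead_coeff q = 1 \<and> irreducible q"
  shows "(\<Prod>q\<in>T. q ^ e q) dvd (\<Prod>q\<in>T. q ^ e' q) \<longleftrightarrow> (\<forall>q\<in>T. e q \<le> e' q)"
proof
  assume dvd: "(\<Prod>q\<in>T. q ^ e q) dvd (\<Prod>q\<in>T. q ^ e' q)"
  show "\<forall>q\<in>T. e q \<le> e' q"
  proof (rule ballI, rule ccontr)
    fix q assume q: "q \<in> T" "\<not> e q \<le> e' q"
    \<comment> \<open>One power more than the right-hand product offers: after cancelling
      \<open>q ^ e' q\<close>, a factor \<open>q\<close> must still divide the product over the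
      other primes.\<close>
    have "q ^ Suc (e' q) dvd q ^ e q" using q by (intro le_imp_power_dvd) simp
    also have "q ^ e q dvd (\<Prod>q\<in>T. q ^ e q)" using q fin by (intro dvd_prodI) auto
    also note dvd
    also have "(\<Prod>q\<in>T. q ^ e' q) = q ^ e' q * (\<Prod>p\<in>T - {q}. p ^ e' p)"
      using q fin by (simp add: prod.remove)
    finally have "q dvd (\<Prod>p\<in>T - {q}. p ^ e' p)"
      using T q by (metis dvd_times_left_cancel_iff mult.commute power_Suc power_not_zero irreducible_def)
    then have "q \<in> T - {q}"
      using monic_irreducible_dvd_prod_power[of "T - {q}" q e'] fin T q by auto
    then show False by simp
  qed
qed (auto intro: prod_dvd_prod le_imp_power_dvd)

text \<open>Induction on the degree: a monic prime factor \<open>q\<close> of \<open>g\<close> lies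
  in \<open>T\<close>, and cancelling it lowers \<open>m q\<close> by one. This is why
  \<open>m\<close> varies in the induction.\<close>

lemma monic_divisor_of_prod_power:
  fixes T :: "'a::field poly set"
  assumes fin: "finite T" and T: "\<And>q. q \<in> T \<Longrightarrow> lead_coeff q = 1 \<and> irreducible q"
    and g: "lead_coeff g = 1" "g dvd (\<Prod>q\<in>T. q ^ m q)"
  shows "\<exists>e. g = (\<Prod>q\<in>T. q ^ e q)"
  using g
proof (induction "degree g" arbitrary: g m rule: less_induct)
  case less
  have g0: "g \<noteq> 0" using less.prems by auto
  show ?case
  proof (cases "is_unit g")
    case True
    then have "g = 1" using monic_dvd_one less.prems by blast
    then show ?thesis by (intro exI[of _ "\<lambda>_. 0"]) simp
  next
    case False
    then obtain q where q: "lead_coeff q = 1" "irreducible q" "q dvd g"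
      using g0 monic_irreducible_factor_exists by blast
    then have "q dvd (\<Prod>q\<in>T. q ^ m q)" using less.prems dvd_trans by blast
    then have qT: "q \<in> T" "m q > 0"
      using monic_irreducible_dvd_prod_power[OF fin T q(1,2)] by auto
    obtain g' where g': "g = q * g'" using q by blast
    have q0: "q \<noteq> 0" "g' \<noteq> 0" using g' g0 by auto
    \<comment> \<open>Splits off one factor \<open>q\<close>. It serves twice: to remove
      \<open>q\<close> from the bound, where \<open>m q\<close> is positive, and to put
      \<open>q\<close> back into the product found for \<open>g'\<close>.\<close>
    have split: "(\<Prod>p\<in>T. p ^ (k(q := Suc n)) p) = q * (\<Prod>p\<in>T. p ^ (k(q := n)) p)" for k n
    proof -
      have "(\<Prod>p\<in>T - {q}. p ^ (k(q := Suc n)) p) = (\<Prod>p\<in>T - {q}. p ^ (k(q := n)) p)"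
        by (intro prod.cong) auto
      then show ?thesis using fin qT
        by (simp add: prod.remove[of T q] mult.assoc del: fun_upd_apply) (simp add: mult.assoc)
    qed
    have "q * g' dvd (\<Prod>p\<in>T. p ^ (m(q := Suc (m q - 1))) p)"
      using less.prems g' qT by simp
    then have "g' dvd (\<Prod>p\<in>T. p ^ (m(q := m q - 1)) p)"
      unfolding split using q0 dvd_times_left_cancel_iff by blast
    moreover have "lead_coeff g' = 1" using less.prems q g' by (simp add: lead_coeff_mult)
    moreover have "degree q > 0"
      using q q0 by (auto simp: is_unit_iff_degree irreducible_def)
    then have "degree g' < degree g" using g' q0 by (simp add: degree_mult_eq)
    ultimately obtain e where "g' = (\<Prod>p\<in>T. p ^ e p)" using less.hyps by blast
    then have "g = (\<Prod>p\<in>T. p ^ (e(q := Suc (e q))) p)"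
      unfolding split by (simp only: g' fun_upd_triv)
    then show ?thesis by blast
  qed
qed

text \<open>\<open>PiE\<close> fixes the values outside \<open>T\<close>, so that each divisor has
  exactly one exponent vector. Injectivity holds because mutual divisibility compares the exponents
  in both directions.\<close>

lemma bij_betw_monic_divisors:
  fixes T :: "'a::field poly set"
  assumes fin: "finite T" and T: "\<And>q. q \<in> T \<Longrightarrow> lead_coeff q = 1 \<and> irreducible q"
  shows "bij_betw (\<lambda>e. \<Prod>q\<in>T. q ^ e q) (PiE T (\<lambda>q. {..m q}))
    {g. lead_coeff g = 1 \<and> g dvd (\<Prod>q\<in>T. q ^ m q)}"
proof (rule bij_betw_imageI)
  show "inj_on (\<lambda>e. \<Prod>q\<in>T. q ^ e q) (PiE T (\<lambda>q. {..m q}))"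
  proof (rule inj_onI)
    fix e e' assume ee: "e \<in> PiE T (\<lambda>q. {..m q})" "e' \<in> PiE T (\<lambda>q. {..m q})"
      and eq: "(\<Prod>q\<in>T. q ^ e q) = (\<Prod>q\<in>T. q ^ e' q)"
    have "\<forall>q\<in>T. e q \<le> e' q" "\<forall>q\<in>T. e' q \<le> e q"
      using prod_power_dvd_iff[OF fin T] eq by (metis dvd_refl)+
    then show "e = e'" using ee by (intro PiE_ext[of e T _ e']) (auto intro: antisym)
  qed
  show "(\<lambda>e. \<Prod>q\<in>T. q ^ e q) ` PiE T (\<lambda>q. {..m q}) = {g. lead_coeff g = 1 \<and> g dvd (\<Prod>q\<in>T. q ^ m q)}"
    (is "?l = ?r")
  proof
    show "?l \<subseteq> ?r"
    proof clarsimp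
      fix e assume e: "e \<in> PiE T (\<lambda>q. {..m q})"
      have "lead_coeff (\<Prod>q\<in>T. q ^ e q) = 1"
        using T by (simp add: lead_coeff_prod lead_coeff_power)
      moreover have "(\<Prod>q\<in>T. q ^ e q) dvd (\<Prod>q\<in>T. q ^ m q)"
        using e prod_power_dvd_iff[OF fin T, of e m] by auto
      ultimately show "lead_coeff (\<Prod>q\<in>T. q ^ e q) = 1 \<and> (\<Prod>q\<in>T. q ^ e q) dvd (\<Prod>q\<in>T. q ^ m q)"
        by blast
    qed
    show "?r \<subseteq> ?l"
    proof
      fix g assume g: "g \<in> ?r"
      then obtain e where e: "g = (\<Prod>q\<in>T. q ^ e q)"
        using monic_divisor_of_prod_power[OF fin T, of g m] by blast
      then have "g = (\<Prod>q\<in>T. q ^ restrict e T q)" by simp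
      moreover have "restrict e T \<in> PiE T (\<lambda>q. {..m q})"
        using g e prod_power_dvd_iff[OF fin T, of e m] by auto
      ultimately show "g \<in> ?l" by blast
    qed
  qed
qed

text \<open>Distinct monic primes dividing \<open>F\<close> can be collected one at a time, so the
  product of any finite set of them divides \<open>F\<close>. A prime factor of the remaining
  cofactor would be one of those already collected, and its square would divide
  \<open>F\<close>.\<close>

lemma squarefree_monic_eq_prod:
  fixes F :: "'a::field poly"
  assumes "lead_coeff F = 1" and sqf: "\<And>q. irreducible q \<Longrightarrow> \<not> q * q dvd F"
  defines "S \<equiv> {q. lead_coeff q = 1 \<and> irreducible q \<and> q dvd F}"
  shows "finite S" "F = \<Prod>S"
proof -
  have S: "\<And>q. q \<in> S \<Longrightarrow> lead_coeff q = 1 \<and> irreducible q" by (simp add: S_def)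
  have F0: "F \<noteq> 0" using assms by auto
  have dvd: "\<Prod>T dvd F" if "finite T" "T \<subseteq> S" for T
    using that
  proof (induction rule: finite_induct)
    case (insert q T)
    then obtain r where r: "F = \<Prod>T * r" by auto
    have q: "lead_coeff q = 1" "irreducible q" "q dvd F" using insert by (auto simp: S_def)
    have "\<not> q dvd \<Prod>T"
      using monic_irreducible_dvd_prod_power[of T q "\<lambda>_. 1"] insert S q by auto
    then have "q dvd r" using q r field_poly_irreducible_imp_prime prime_elem_dvd_mult_iff by blast
    then show ?case using r insert by (auto simp: mult_ac dest: mult_dvd_mono)
  qed auto
  have deg1: "degree q \<ge> 1" if "q \<in> S" for q
    using S[OF that] by (auto simp: is_unit_iff_degree irreducible_def Suc_le_eq)
  \<comment> \<open>A bound that is uniform over the finite subsets of \<open>S\<close> yields the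
    finiteness of \<open>S\<close> itself.\<close>
  have bound: "card T \<le> degree F" if "finite T" "T \<subseteq> S" for T
  proof -
    have "card T \<le> (\<Sum>q\<in>T. degree q)"
      using deg1 that by (metis card_eq_sum sum_mono subsetD)
    also have "\<dots> = degree (\<Prod>T)"
      using that S[of 0] by (subst degree_prod_eq_sum_degree) auto
    also have "\<dots> \<le> degree F" using dvd that F0 by (simp add: dvd_imp_degree_le)
    finally show ?thesis .
  qed
  show fin: "finite S"
    using bound by (metis finite_if_finite_subsets_card_bdd)
  obtain r where r: "F = \<Prod>S * r" using dvd[OF fin] by auto
  have "lead_coeff (\<Prod>S) = 1" using S by (simp add: lead_coeff_prod)
  then have lr: "lead_coeff r = 1" using r assms(1) by (simp add: lead_coeff_mult)
  have "is_unit r"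
  proof (rule ccontr)
    assume "\<not> is_unit r"
    moreover have "r \<noteq> 0" using lr by auto
    ultimately obtain q where q: "lead_coeff q = 1" "irreducible q" "q dvd r"
      using monic_irreducible_factor_exists by blast
    moreover have "q dvd F" using r q(3) dvd_mult by metis
    ultimately have "q \<in> S" by (simp add: S_def)
    then have "q dvd \<Prod>S" using fin by (simp add: dvd_prod_eqI)
    then have "q * q dvd F" using r q(3) mult_dvd_mono by metis
    then show False using sqf q by blast
  qed
  then have "r = 1" using lr monic_dvd_one by blast
  then show "F = \<Prod>S" using r by simp
qed

section \<open>Counting exponent vectors\<close>

text \<open>A function on a disjoint union amounts to a family of functions on the blocks. If the
  condition constrains each block separately, the numbers of choices multiply.\<close>

lemma card_PiE_UN_factorwise:
  assumes fin: "finite I" and disj: "disjoint_family_on S I"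
  shows "card {e \<in> PiE (\<Union>i\<in>I. S i) B. \<forall>i\<in>I. P i (restrict e (S i))}
    = (\<Prod>i\<in>I. card {e \<in> PiE (S i) B. P i e})" (is "card ?A = _")
proof -
  let ?D = "PiE I (\<lambda>i. {e \<in> PiE (S i) B. P i e})"
  let ?h = "\<lambda>e. \<lambda>i\<in>I. restrict e (S i)"
  have "bij_betw ?h ?A ?D"
  proof (rule bij_betw_imageI)
    show "inj_on ?h ?A"
    proof (rule inj_onI)
      fix e e' assume e: "e \<in> ?A" "e' \<in> ?A" "?h e = ?h e'"
      show "e = e'"
      proof (rule PiE_ext[of e "\<Union>i\<in>I. S i" B e'])
        fix x assume "x \<in> (\<Union>i\<in>I. S i)"
        then obtain i where "i \<in> I" "x \<in> S i" by blast
        then show "e x = e' x" using e(3) by (auto dest!: fun_cong[of _ _ i] fun_cong[of _ _ x])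
      qed (use e in auto)
    qed
    show "?h ` ?A = ?D"
    proof
      show "?h ` ?A \<subseteq> ?D" by auto
      show "?D \<subseteq> ?h ` ?A"
      proof
        fix t assume t: "t \<in> ?D"
        \<comment> \<open>The inverse map glues the family \<open>t\<close>; disjointness makes the
          block of \<open>x\<close> unique, so that \<open>THE\<close> is well defined.\<close>
        define e where "e = (\<lambda>x\<in>(\<Union>i\<in>I. S i). t (THE i. i \<in> I \<and> x \<in> S i) x)"
        have e: "e x = t i x" if "i \<in> I" "x \<in> S i" for i x
        proof -
          have "(THE i. i \<in> I \<and> x \<in> S i) = i"
            using that disj by (intro the_equality) (auto simp: disjoint_family_on_def)
          then show ?thesis using that by (auto simp: e_def)
        qed
        have r: "restrict e (S i) = t i" if "i \<in> I" for i
        proof -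
          have ti: "t i \<in> PiE (S i) B" using t that by (auto simp: PiE_iff)
          show ?thesis
          proof
            fix x show "restrict e (S i) x = t i x"
              using ti e[OF that, of x] by (cases "x \<in> S i") auto
          qed
        qed
        have "e \<in> PiE (\<Union>i\<in>I. S i) B"
        proof (rule PiE_I)
          fix x assume "x \<in> (\<Union>i\<in>I. S i)"
          then obtain i where i: "i \<in> I" "x \<in> S i" by blast
          then have "t i \<in> PiE (S i) B" using t by (auto simp: PiE_iff)
          then show "e x \<in> B x" using e[OF i] i by auto
        qed (simp add: e_def)
        moreover have "\<forall>i\<in>I. P i (restrict e (S i))" using r t by (auto simp: PiE_iff)
        moreover have "?h e = t"
        proof
          fix i show "?h e i = t i" using r t by (cases "i \<in> I") auto
        qed
        ultimately show "t \<in> ?h ` ?A" by blast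
      qed
    qed
  qed
  then show ?thesis using fin by (simp add: bij_betw_same_card card_PiE)
qed

text \<open>The complement consists of the functions all of whose values are below
  \<open>m\<close>.\<close>

lemma card_PiE_attaining_max:
  assumes "finite S"
  shows "card {e \<in> PiE S (\<lambda>_. {..m::nat}). \<exists>q\<in>S. e q = m} = (m + 1) ^ card S - m ^ card S"
proof -
  have "{e \<in> PiE S (\<lambda>_. {..m}). \<exists>q\<in>S. e q = m} = PiE S (\<lambda>_. {..m}) - PiE S (\<lambda>_. {..<m})"
    by (auto simp: PiE_iff extensional_def) (metis le_neq_implies_less linorder_not_less)
  moreover have "card (PiE S (\<lambda>_. {..m}) - PiE S (\<lambda>_. {..<m}))
      = card (PiE S (\<lambda>_. {..m})) - card (PiE S (\<lambda>_. {..<m}))"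
    using assms by (intro card_Diff_subset finite_PiE PiE_mono) auto
  ultimately show ?thesis using assms by (simp add: card_PiE)
qed

section \<open>Equality cases for products of reals and differences of powers\<close>

lemma prod_eq_iff_of_le:
  fixes a b :: "'i \<Rightarrow> real"
  assumes "finite I" "\<And>i. i \<in> I \<Longrightarrow> 0 < a i" "\<And>i. i \<in> I \<Longrightarrow> a i \<le> b i"
  shows "prod a I = prod b I \<longleftrightarrow> (\<forall>i\<in>I. a i = b i)"
proof
  assume eq: "prod a I = prod b I"
  show "\<forall>i\<in>I. a i = b i"
  proof (rule ballI, rule ccontr)
    fix i assume i: "i \<in> I" "a i \<noteq> b i"
    \<comment> \<open>Strictness at \<open>i\<close> survives the multiplication because the
      remaining product of \<open>a\<close> is positive.\<close>
    have "a i * prod a (I - {i}) < b i * prod b (I - {i})"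
    proof (rule mult_less_le_imp_less)
      show "a i < b i" using i assms(3)[of i] by simp
      show "prod a (I - {i}) \<le> prod b (I - {i})"
        using assms by (intro prod_mono) (auto intro: less_imp_le)
      show "0 \<le> a i" using assms(2)[of i] i by simp
      show "0 < prod a (I - {i})" using assms(2) by (intro prod_pos) auto
    qed
    then show False using eq assms(1) i by (simp add: prod.remove[of I i])
  qed
qed simp

text \<open>For \<open>k = Suc j\<close> with \<open>j\<close> positive, \<open>(m + 1) ^ k\<close>
  is \<open>(m + 1) ^ j\<close> plus \<open>m * (m + 1) ^ j\<close>. The first summand is at least 2
  and the second at least \<open>m ^ k\<close>, so the difference exceeds 1.\<close>

lemma power_diff_eq_1_iff:
  assumes "m \<ge> (1::nat)" "k \<ge> 1"
  shows "(m + 1) ^ k - m ^ k = 1 \<longleftrightarrow> k = 1"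
proof
  assume eq: "(m + 1) ^ k - m ^ k = 1"
  show "k = 1"
  proof (rule ccontr)
    assume "k \<noteq> 1"
    then obtain j where j: "k = Suc j" "j \<ge> 1" using assms(2) by (cases k) auto
    have le: "m ^ j \<le> (m + 1) ^ j" by (intro power_mono) auto
    have "2 ^ 1 \<le> (2::nat) ^ j" using j by (intro power_increasing) auto
    also have "\<dots> \<le> (m + 1) ^ j" using assms by (intro power_mono) auto
    finally have two: "2 \<le> (m + 1) ^ j" by simp
    have "m * m ^ j \<le> m * (m + 1) ^ j" using le by simp
    then have "m * m ^ j + 2 \<le> (m + 1) ^ j + m * (m + 1) ^ j" using two by linarith
    then have "m ^ k + 2 \<le> (m + 1) ^ k" using j by simp
    then show False using eq by linarith
  qed
qed simp

section \<open>The cyclic module of a matrix\<close>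

text \<open>This is p(A) v, the orbit map of \<open>v\<close> for the module structure over the
  polynomial ring given by \<open>A\<close>. Iterating on the vector avoids powers of the matrix and
  makes Horner's rule available.\<close>

definition poly_act :: "'a::field ^ 'n ^ 'n \<Rightarrow> 'a ^ 'n \<Rightarrow> 'a poly \<Rightarrow> 'a ^ 'n" where
  "poly_act A v p = (\<Sum>i\<le>degree p. coeff p i *s (((*v) A ^^ i) v))"

lemma poly_act_eq_sum:
  assumes "degree p \<le> k"
  shows "poly_act A v p = (\<Sum>i\<le>k. coeff p i *s (((*v) A ^^ i) v))"
  unfolding poly_act_def
  using assms by (intro sum.mono_neutral_left) (auto simp: coeff_eq_0)

lemma poly_act_0 [simp]: "poly_act A v 0 = 0"
  by (simp add: poly_act_def)

lemma poly_act_add: "poly_act A v (p + q) = poly_act A v p + poly_act A v q"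
proof -
  let ?k = "max (degree p) (degree q)"
  have "degree (p + q) \<le> ?k" by (simp add: degree_add_le_max)
  then show ?thesis
    using poly_act_eq_sum[of "p + q" ?k A v] poly_act_eq_sum[of p ?k A v] poly_act_eq_sum[of q ?k A v]
    by (simp add: sum.distrib vec.scale_left_distrib)
qed

lemma poly_act_smult: "poly_act A v (smult c p) = c *s poly_act A v p"
  using poly_act_eq_sum[of "smult c p" "degree p" A v]
  by (simp add: poly_act_def vec.scale_sum_right)

text \<open>Horner's rule; the later inductions over polynomials rest on it.\<close>

lemma poly_act_pCons: "poly_act A v (pCons a p) = a *s v + A *v poly_act A v p"
proof -
  have "poly_act A v (pCons a p) = (\<Sum>i\<le>Suc (degree p). coeff (pCons a p) i *s (((*v) A ^^ i) v))"
    by (rule poly_act_eq_sum) (simp add: degree_pCons_le)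
  also have "\<dots> = a *s v + (\<Sum>i\<le>degree p. coeff p i *s (A *v (((*v) A ^^ i) v)))"
    by (subst sum.atMost_Suc_shift) simp
  also have "(\<Sum>i\<le>degree p. coeff p i *s (A *v (((*v) A ^^ i) v))) = A *v poly_act A v p"
    by (simp add: poly_act_def vec.sum vec.scale)
  finally show ?thesis .
qed

lemma poly_act_mult: "poly_act A v (p * q) = poly_act A (poly_act A v q) p"
  by (induction p) (simp_all add: poly_act_pCons poly_act_add poly_act_smult)

lemma poly_act_vector_0 [simp]: "poly_act A 0 p = 0"
  by (induction p) (simp_all add: poly_act_pCons)

lemma poly_act_mult_eq_0:
  "poly_act A v p = 0 \<Longrightarrow> poly_act A v (q * p) = 0"
  by (simp add: poly_act_mult)

lemma poly_act_diff: "poly_act A v (p - q) = poly_act A v p - poly_act A v q"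
  using poly_act_add[of A v "p - q" q] by simp

lemma poly_act_monom: "poly_act A v (monom 1 k) = ((*v) A ^^ k) v"
  by (induction k) (simp_all add: monom_Suc poly_act_pCons monom_0)

lemma poly_act_in_invariant_subspace:
  assumes "vec.subspace C" "\<And>c. c \<in> C \<Longrightarrow> A *v c \<in> C" "v \<in> C"
  shows "poly_act A v p \<in> C"
  using assms
  by (induction p) (auto simp: poly_act_pCons intro: vec.subspace_0 vec.subspace_add vec.subspace_scale)

text \<open>Links the minimal polynomial, which is defined through matrices, to the action on a
  single vector.\<close>

lemma poly_mat_vector_mult: "poly_mat p A *v v = poly_act A v p"
proof -
  have pow: "((**) A ^^ i) (mat 1) *v v = ((*v) A ^^ i) v" for i
    by (induction i) (simp_all add: matrix_vector_mul_assoc[symmetric])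
  have "(poly_mat p A *v v) $ r = poly_act A v p $ r" for r
  proof -
    have "(poly_mat p A *v v) $ r
      = (\<Sum>j\<in>UNIV. \<Sum>i\<le>degree p. coeff p i * (((**) A ^^ i) (mat 1)) $ r $ j * v $ j)"
      by (simp add: poly_mat_def matrix_vector_mult_def sum_distrib_right)
    also have "\<dots> = (\<Sum>i\<le>degree p. coeff p i * (((**) A ^^ i) (mat 1) *v v) $ r)"
      by (subst sum.swap) (simp add: matrix_vector_mult_def sum_distrib_left mult.assoc)
    finally show ?thesis by (simp add: pow poly_act_def)
  qed
  then show ?thesis by (simp add: vec_eq_iff)
qed

text \<open>Vanishing coefficients from \<open>m\<close> on replace a strict degree bound: the
  condition covers the zero polynomial for every \<open>m\<close> and is closed under linear
  combinations.\<close>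

lemma poly_act_surj_low_degree:
  fixes A :: "'a::field ^ 'n ^ 'n"
  assumes "w \<in> vec.span ((\<lambda>k. ((*v) A ^^ k) v) ` {..<m})"
  shows "\<exists>p. (\<forall>i\<ge>m. coeff p i = 0) \<and> poly_act A v p = w"
  using assms
proof (induction rule: vec.span_induct_alt)
  case base
  show ?case by (intro exI[of _ 0]) simp
next
  case (step c x y)
  then obtain k p where k: "k < m" "x = ((*v) A ^^ k) v"
    and p: "\<forall>i\<ge>m. coeff p i = 0" "poly_act A v p = y" by blast
  show ?case
    using k p
    by (intro exI[of _ "smult c (monom 1 k) + p"]) (auto simp: poly_act_add poly_act_smult poly_act_monom)
qed

text \<open>Reduction modulo \<open>h\<close> shows that the first \<open>degree h\<close> iterates
  of \<open>v\<close> already span the space. The lemma is applied over both K and L.\<close>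

lemma card_le_degree_of_annihilator:
  fixes A :: "'a::field ^ 'n ^ 'n"
  assumes surj: "surj (poly_act A v)" and h: "h \<noteq> 0" "poly_act A v h = 0"
  shows "CARD('n) \<le> degree h"
proof -
  let ?S = "(\<lambda>k. ((*v) A ^^ k) v) ` {..<degree h}"
  have "w \<in> vec.span ?S" for w
  proof -
    obtain p where p: "w = poly_act A v p" using surj by blast
    have "poly_act A v p = poly_act A v (p div h * h + p mod h)" by simp
    also have "\<dots> = poly_act A v (p mod h)"
      using h by (simp only: poly_act_add poly_act_mult poly_act_vector_0 add_0_left)
    finally have w: "w = poly_act A v (p mod h)" using p by simp
    show ?thesis
    proof (cases "p mod h = 0")
      case True
      then show ?thesis using w by (simp add: vec.span_zero)
    next
      case False
      then have "degree (p mod h) < degree h" using degree_mod_less[of h p] h by auto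
      then show ?thesis unfolding w poly_act_def
        by (intro vec.span_sum vec.span_scale vec.span_base) auto
    qed
  qed
  then have "vec.dim (UNIV :: ('a^'n) set) \<le> card ?S"
    by (intro vec.dim_le_card) auto
  also have "\<dots> \<le> card {..<degree h}" by (rule card_image_le) simp
  finally show ?thesis unfolding vec_dim_card by simp
qed

lemma cyclic_matrix_min_poly:
  fixes A :: "'a::field ^ 'n ^ 'n"
  assumes "cyclic_matrix A" "is_min_poly A f"
  obtains v where "surj (poly_act A v)" "\<And>p. poly_act A v p = 0 \<longleftrightarrow> f dvd p" "degree f = CARD('n)"
proof -
  obtain v where span: "vec.span ((\<lambda>k. ((*v) A ^^ k) v) ` {..<CARD('n)}) = UNIV"
    using assms(1) unfolding cyclic_matrix_def Let_def by auto
  have f: "lead_coeff f = 1" "poly_mat f A = 0" "\<And>g. poly_mat g A = 0 \<Longrightarrow> f dvd g"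
    using assms(2) unfolding is_min_poly_def by auto
  have f0: "f \<noteq> 0" using f by auto
  have low: "\<exists>p. (\<forall>i\<ge>CARD('n). coeff p i = 0) \<and> poly_act A v p = w" for w
    using poly_act_surj_low_degree[of w A v "CARD('n)"] span by simp
  then have surj: "surj (poly_act A v)" by (metis surjI)
  have fv: "poly_act A v f = 0"
    using f by (simp flip: poly_mat_vector_mult)
  have ann: "poly_act A v p = 0 \<longleftrightarrow> f dvd p" for p
  proof
    assume p: "poly_act A v p = 0"
    have "poly_mat p A *v w = 0" for w
    proof -
      obtain q where "w = poly_act A v q" using surj by blast
      \<comment> \<open>Polynomials in \<open>A\<close> commute and every vector is q(A) v, so a
        polynomial that annihilates the cyclic vector annihilates the whole space.\<close>
      then have "poly_mat p A *v w = poly_act A v (p * q)"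
        by (simp add: poly_mat_vector_mult poly_act_mult)
      also have "\<dots> = 0" using p by (subst mult.commute) (rule poly_act_mult_eq_0)
      finally show ?thesis .
    qed
    then have "poly_mat p A = 0" by (simp add: matrix_eq)
    then show "f dvd p" by (rule f)
  qed (metis dvdE fv mult.commute poly_act_mult_eq_0)
  have "degree f \<le> CARD('n)"
  proof -
    \<comment> \<open>With n the dimension, A^n v is a combination of lower iterates. The difference
      \<open>?h\<close> annihilates \<open>v\<close>, has degree at most n, and is nonzero because
      its coefficient at n is 1.\<close>
    obtain p where p: "\<forall>i\<ge>CARD('n). coeff p i = 0" "poly_act A v p = ((*v) A ^^ CARD('n)) v"
      using low by blast
    let ?h = "monom 1 (CARD('n)) - p"
    have "poly_act A v ?h = 0" using p by (simp add: poly_act_diff poly_act_monom)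
    then have "f dvd ?h" using ann by simp
    moreover have "coeff ?h (CARD('n)) = 1" using p by simp
    then have "?h \<noteq> 0" by (metis coeff_0 zero_neq_one)
    moreover have "degree ?h \<le> CARD('n)" using p by (intro degree_le) auto
    ultimately show ?thesis using dvd_imp_degree_le le_trans by blast
  qed
  moreover have "CARD('n) \<le> degree f"
    using card_le_degree_of_annihilator[OF surj f0 fv] .
  ultimately show ?thesis using that surj ann by auto
qed

section \<open>Cyclic codes over a field extension\<close>

locale field_embedding =
  fixes emb :: "'k::field \<Rightarrow> 'l::field"
  assumes ext: "is_field_ext emb"
begin

lemma emb_1 [simp]: "emb 1 = 1" and emb_add: "emb (a + b) = emb a + emb b"
  and emb_mult: "emb (a * b) = emb a * emb b"
  using ext by (auto simp: is_field_ext_def)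

lemma emb_0 [simp]: "emb 0 = 0"
  by (metis add_0 add_cancel_right_left emb_add)

lemma emb_eq_0_iff [simp]: "emb a = 0 \<longleftrightarrow> a = 0"
proof
  assume "emb a = 0"
  then have "a \<noteq> 0 \<Longrightarrow> emb (a * inverse a) = 0" by (simp only: emb_mult) simp
  then show "a = 0" by auto
qed simp

lemma emb_sum: "emb (sum g S) = (\<Sum>x\<in>S. emb (g x))"
  by (induction S rule: infinite_finite_induct) (auto simp: emb_add)

lemma emb_of_nat: "emb (of_nat k) = of_nat k"
  by (induction k) (auto simp: emb_add)

lemma map_poly_add: "map_poly emb (p + q) = map_poly emb p + map_poly emb q"
  by (rule poly_eqI) (simp add: coeff_map_poly emb_add)

lemma map_poly_mult: "map_poly emb (p * q) = map_poly emb p * map_poly emb q"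
  by (rule poly_eqI) (simp add: coeff_map_poly coeff_mult emb_sum emb_mult)

lemma map_poly_power: "map_poly emb (p ^ k) = map_poly emb p ^ k"
  by (induction k) (simp_all add: map_poly_mult)

lemma map_poly_prod: "map_poly emb (prod g S) = (\<Prod>x\<in>S. map_poly emb (g x))"
  by (induction S rule: infinite_finite_induct) (auto simp: map_poly_mult)

lemma map_poly_pderiv: "map_poly emb (pderiv p) = pderiv (map_poly emb p)"
  by (rule poly_eqI) (simp add: coeff_map_poly coeff_pderiv emb_mult emb_add emb_of_nat)

lemma degree_map_poly_emb [simp]: "degree (map_poly emb p) = degree p"
  by (simp add: degree_map_poly)

lemma map_poly_dvd: "p dvd q \<Longrightarrow> map_poly emb p dvd map_poly emb q"
  by (auto elim!: dvdE simp: map_poly_mult)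

section \<open>Vectors over K inside L^n and the cyclic module over L\<close>

definition emb_vec :: "'k ^ 'n \<Rightarrow> 'l ^ 'n" where
  "emb_vec w = (\<chi> i. emb (w $ i))"

lemma emb_vec_eq_0_iff: "emb_vec w = 0 \<longleftrightarrow> w = 0"
  by (simp add: emb_vec_def vec_eq_iff)

lemma emb_vec_0 [simp]: "emb_vec 0 = 0"
  by (simp add: emb_vec_eq_0_iff)

lemma emb_vec_add: "emb_vec (v + w) = emb_vec v + emb_vec w"
  by (simp add: emb_vec_def vec_eq_iff emb_add)

lemma emb_vec_scale: "emb_vec (a *s w) = emb a *s emb_vec w"
  by (simp add: emb_vec_def vec_eq_iff emb_mult)

lemma emb_vec_matrix_mult: "emb_vec (A *v w) = map_mat emb A *v emb_vec w"
  by (simp add: emb_vec_def vec_eq_iff map_mat_def matrix_vector_mult_def emb_sum emb_mult)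

lemma emb_vec_poly_act:
  "emb_vec (poly_act A v p) = poly_act (map_mat emb A) (emb_vec v) (map_poly emb p)"
  by (induction p)
    (simp_all add: poly_act_pCons emb_vec_add emb_vec_scale emb_vec_matrix_mult map_poly_pCons)

text \<open>The range is an L-subspace, and it contains the standard basis because these vectors
  come from K^n, where surjectivity is assumed.\<close>

lemma surj_poly_act_map_mat:
  assumes "surj (poly_act A v)"
  shows "surj (poly_act (map_mat emb A) (emb_vec v))"
proof -
  let ?R = "range (poly_act (map_mat emb A) (emb_vec v))"
  have sub: "vec.subspace ?R"
  proof (rule vec.subspaceI)
    show "0 \<in> ?R" by (metis poly_act_0 rangeI)
    show "x + y \<in> ?R" if "x \<in> ?R" "y \<in> ?R" for x y
      using that by (auto simp flip: poly_act_add)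
    show "c *s x \<in> ?R" if "x \<in> ?R" for c x
      using that by (auto simp flip: poly_act_smult)
  qed
  have ax: "axis i 1 \<in> ?R" for i
  proof -
    have "axis i 1 = emb_vec (axis i 1)" by (simp add: emb_vec_def axis_def vec_eq_iff)
    moreover obtain p where "axis i 1 = poly_act A v p" using assms by blast
    ultimately have "axis i 1 = poly_act (map_mat emb A) (emb_vec v) (map_poly emb p)"
      by (simp add: emb_vec_poly_act)
    then show ?thesis by blast
  qed
  have "x \<in> ?R" for x
  proof -
    have "(\<Sum>i\<in>UNIV. x $ i *s axis i 1) \<in> ?R"
      using sub ax by (intro vec.subspace_sum vec.subspace_scale) auto
    then show ?thesis by (simp add: basis_expansion)
  qed
  then show ?thesis by blast
qed

text \<open>The annihilator does not shrink to a proper divisor over L: its monic generator divides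
  the image of \<open>f\<close>, and surjectivity forces its degree to be at least the dimension,
  which is the degree of \<open>f\<close>.\<close>

lemma poly_act_map_mat_eq_0_iff:
  fixes A :: "'k ^ 'n ^ 'n"
  assumes surj: "surj (poly_act A v)" and ann: "\<And>p. poly_act A v p = 0 \<longleftrightarrow> f dvd p"
    and f: "lead_coeff f = 1" "degree f = CARD('n)"
  shows "poly_act (map_mat emb A) (emb_vec v) p = 0 \<longleftrightarrow> map_poly emb f dvd p"
proof -
  let ?act = "poly_act (map_mat emb A) (emb_vec v)" and ?F = "map_poly emb f"
  have F: "lead_coeff ?F = 1" using f by (simp add: coeff_map_poly)
  then have F0: "?F \<noteq> 0" by (metis coeff_0 zero_neq_one)
  have FJ: "?act ?F = 0"
    using ann[of f] by (simp flip: emb_vec_poly_act)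
  obtain h where h: "lead_coeff h = 1" "{p. ?act p = 0} = {p. h dvd p}"
    by (rule field_poly_ideal_principal[of "{p. ?act p = 0}"])
      (use F0 FJ in \<open>auto simp: poly_act_add poly_act_mult_eq_0\<close>)
  have ker: "?act p = 0 \<longleftrightarrow> h dvd p" for p
    using h(2) by (simp add: set_eq_iff)
  have h0: "h \<noteq> 0" using h(1) by auto
  have "CARD('n) \<le> degree h"
    using surj_poly_act_map_mat[OF surj] h0
  proof (rule card_le_degree_of_annihilator)
    show "?act h = 0" by (simp add: ker)
  qed
  moreover obtain r where r: "?F = h * r" using FJ ker by (auto elim!: dvdE)
  moreover have "r \<noteq> 0" using r F0 by auto
  ultimately have "degree r = 0"
    using h0 f(2) degree_mult_eq[of h r] degree_map_poly_emb[of f] by simp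
  moreover have "lead_coeff r = 1" using r F h(1) by (simp add: lead_coeff_mult)
  ultimately have "r = 1" by (auto elim!: degree_eq_zeroE)
  then have "h = ?F" using r by simp
  then show ?thesis using ker by simp
qed

text \<open>Preimages of codes under \<open>act\<close> are ideals containing the image of
  \<open>f\<close>. The second claim reduces the search for vectors of K^n in a code to
  divisibility, as each such vector is h(A) v with \<open>h\<close> over K and vanishes exactly when
  \<open>f\<close> divides \<open>h\<close>.\<close>

lemma bij_betw_monic_divisors_cyclic_codes:
  fixes A :: "'k ^ 'n ^ 'n"
  assumes surj: "surj (poly_act A v)" and ann: "\<And>p. poly_act A v p = 0 \<longleftrightarrow> f dvd p"
    and f: "lead_coeff f = 1" "degree f = CARD('n)"
  defines "act \<equiv> poly_act (map_mat emb A) (emb_vec v)"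
  shows "bij_betw (\<lambda>g. act ` {p. g dvd p})
      {g. lead_coeff g = 1 \<and> g dvd map_poly emb f} (cyclic_codes emb A)" (is "bij_betw ?c ?D _")
    and "\<And>g. g dvd map_poly emb f \<Longrightarrow>
      (\<exists>w. w \<noteq> 0 \<and> emb_vec w \<in> act ` {p. g dvd p})
        \<longleftrightarrow> (\<exists>h. g dvd map_poly emb h \<and> \<not> f dvd h)"
proof -
  let ?F = "map_poly emb f"
  have F0: "?F \<noteq> 0" using f by (metis degree_map_poly_emb degree_0 zero_less_card_finite less_irrefl)
  have act0: "act p = 0 \<longleftrightarrow> ?F dvd p" for p
    unfolding act_def by (rule poly_act_map_mat_eq_0_iff[OF surj ann f])
  have act_add: "act (p + q) = act p + act q" and act_smult: "act (smult c p) = c *s act p"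
    and act_X: "act (pCons 0 p) = map_mat emb A *v act p" for p q c
    unfolding act_def by (simp_all add: poly_act_add poly_act_smult poly_act_pCons)
  have act_surj: "surj act" unfolding act_def by (rule surj_poly_act_map_mat[OF surj])
  \<comment> \<open>Two polynomials that represent the same word differ by a multiple of
    \<open>?F\<close>, hence of \<open>g\<close>, so divisibility by \<open>g\<close> does not
    depend on the representative.\<close>
  have mem: "act p \<in> ?c g \<longleftrightarrow> g dvd p" if "g dvd ?F" for g p
  proof
    assume "act p \<in> ?c g"
    then obtain q where q: "g dvd q" "act p = act q" by blast
    then have "act (p - q) = 0" by (simp add: act_def poly_act_diff)
    then have "g dvd p - q" using act0 that dvd_trans by blast
    then show "g dvd p" using q(1) dvd_add[of g "p - q" q] by simp
  qed blast
  show "bij_betw ?c ?D (cyclic_codes emb A)"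
  proof (rule bij_betw_imageI)
    show "inj_on ?c ?D"
    proof (rule inj_onI)
      fix g h assume gh: "g \<in> ?D" "h \<in> ?D" "?c g = ?c h"
      then have "g dvd h" "h dvd g"
        using mem[of g h] mem[of h h] mem[of g g] mem[of h g] by simp_all
      then show "g = h" using gh monic_dvd_antisym by blast
    qed
    show "?c ` ?D = cyclic_codes emb A"
    proof
      show "?c ` ?D \<subseteq> cyclic_codes emb A"
      proof
        fix C assume "C \<in> ?c ` ?D"
        then obtain g where g: "C = ?c g" by blast
        have "vec.subspace C"
        proof (rule vec.subspaceI)
          show "0 \<in> C" unfolding g using act0[of 0] by force
          show "x + y \<in> C" if "x \<in> C" "y \<in> C" for x y
            using that unfolding g by (auto simp flip: act_add)
          show "c *s x \<in> C" if "x \<in> C" for c x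
            using that unfolding g by (auto simp flip: act_smult intro: dvd_smult)
        qed
        moreover have "map_mat emb A *v c \<in> C" if "c \<in> C" for c
        proof -
          have "c \<in> ?c g" using that g by simp
          then obtain p where "g dvd p" "c = act p" by blast
          moreover from this have "g dvd pCons 0 p"
            using dvd_mult[of g p "[:0, 1:]"] by simp
          ultimately show ?thesis unfolding g by (auto simp flip: act_X)
        qed
        ultimately show "C \<in> cyclic_codes emb A" by (simp add: cyclic_codes_def)
      qed
      show "cyclic_codes emb A \<subseteq> ?c ` ?D"
      proof
        fix C assume "C \<in> cyclic_codes emb A"
        then have C: "vec.subspace C" "\<And>c. c \<in> C \<Longrightarrow> map_mat emb A *v c \<in> C"
          by (auto simp: cyclic_codes_def)
        have FC: "act ?F \<in> C" using act0[of ?F] C by (simp add: vec.subspace_0)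
        have addC: "act (p + q) \<in> C" if "act p \<in> C" "act q \<in> C" for p q
          using that C by (simp add: act_add vec.subspace_add)
        have multC: "act (q * p) \<in> C" if "act p \<in> C" for p q
          using poly_act_in_invariant_subspace[OF C that] by (simp add: act_def poly_act_mult)
        \<comment> \<open>Stability under the matrix makes the preimage of \<open>C\<close> an
          ideal. The member \<open>?F\<close> shows that it is nonzero and that its generator
          divides \<open>?F\<close>.\<close>
        obtain g where g: "lead_coeff g = 1" "{p. act p \<in> C} = {p. g dvd p}"
          by (rule field_poly_ideal_principal[of "{p. act p \<in> C}"])
            (use F0 FC addC multC in auto)
        then have "g \<in> ?D" using FC by (auto simp: set_eq_iff)
        moreover have "C = ?c g"
        proof -
          have "C = act ` {p. act p \<in> C}" using act_surj by (auto simp: surj_def image_iff)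
          then show ?thesis using g by simp
        qed
        ultimately show "C \<in> ?c ` ?D" by blast
      qed
    qed
  qed
  fix g assume g: "g dvd ?F"
  have emb_act: "emb_vec (poly_act A v h) = act (map_poly emb h)" for h
    by (simp add: act_def emb_vec_poly_act)
  show "(\<exists>w. w \<noteq> 0 \<and> emb_vec w \<in> ?c g) \<longleftrightarrow> (\<exists>h. g dvd map_poly emb h \<and> \<not> f dvd h)"
  proof -
    have iff: "w \<noteq> 0 \<and> emb_vec w \<in> ?c g \<longleftrightarrow> g dvd map_poly emb h \<and> \<not> f dvd h"
      if "w = poly_act A v h" for w h
      using mem[OF g] ann by (auto simp only: that emb_act)
    show ?thesis
    proof
      assume "\<exists>w. w \<noteq> 0 \<and> emb_vec w \<in> ?c g"
      then obtain w where w: "w \<noteq> 0 \<and> emb_vec w \<in> ?c g" ..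
      obtain h where "w = poly_act A v h" using surj by blast
      then show "\<exists>h. g dvd map_poly emb h \<and> \<not> f dvd h" using iff w by blast
    next
      assume "\<exists>h. g dvd map_poly emb h \<and> \<not> f dvd h"
      then show "\<exists>w. w \<noteq> 0 \<and> emb_vec w \<in> ?c g" using iff[OF refl] by blast
    qed
  qed
qed

section \<open>Rank weight one\<close>

lemma vector_space_ext_scale: "vector_space (ext_scale emb)"
  by unfold_locales (simp_all add: ext_scale_def emb_add emb_mult algebra_simps)

lemma rank_wt_le_card: "rank_wt emb (c :: 'l ^ 'n) \<le> CARD('n)"
proof -
  interpret L: vector_space "ext_scale emb" by (rule vector_space_ext_scale)
  have "L.dim (range (\<lambda>i. c $ i)) \<le> card (range (\<lambda>i. c $ i))"
    by (intro L.dim_le_card L.span_superset) simp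
  also have "\<dots> \<le> CARD('n)" by (rule card_image_le) simp
  finally show ?thesis by (simp add: rank_wt_def)
qed

lemma rank_wt_basis:
  fixes c :: "'l ^ 'n"
  obtains B where "finite B" "card B = rank_wt emb c" "\<And>i. c $ i \<in> module.span (ext_scale emb) B"
proof -
  interpret L: vector_space "ext_scale emb" by (rule vector_space_ext_scale)
  let ?V = "range (\<lambda>i. c $ i)"
  obtain B where B: "B \<subseteq> ?V" "L.independent B" "?V \<subseteq> L.span B" "card B = L.dim ?V"
    using L.basis_exists by blast
  show ?thesis
  proof (rule that)
    show "finite B" using B(1) by (rule finite_subset) simp
    show "card B = rank_wt emb c" using B by (simp add: rank_wt_def)
    show "c $ i \<in> L.span B" for i using B by blast
  qed
qed

lemma rank_wt_pos:
  assumes "c \<noteq> 0"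
  shows "rank_wt emb (c :: 'l ^ 'n) \<ge> 1"
proof (rule ccontr)
  interpret L: vector_space "ext_scale emb" by (rule vector_space_ext_scale)
  assume "\<not> rank_wt emb c \<ge> 1"
  then have r: "rank_wt emb c = 0" by simp
  obtain B where B: "finite B" "card B = rank_wt emb c" "\<And>i. c $ i \<in> L.span B"
    using rank_wt_basis[of c] by blast
  have "B = {}" using B(1,2) r by simp
  then have "c $ i = 0" for i using B(3)[of i] by simp
  then show False using assms by (simp add: vec_eq_iff)
qed

text \<open>The entries lie on a K-line spanned by some \<open>b\<close>; their coordinates along
  \<open>b\<close> form \<open>w\<close>.\<close>

lemma rank_wt_eq_1D:
  assumes "rank_wt emb (c :: 'l ^ 'n) = 1"
  obtains b w where "c = b *s emb_vec w"
proof -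
  interpret L: vector_space "ext_scale emb" by (rule vector_space_ext_scale)
  obtain B where B: "card B = 1" "\<And>i. c $ i \<in> L.span B"
    using assms rank_wt_basis[of c] by metis
  then obtain b where "B = {b}" by (auto simp: card_1_singleton_iff)
  then have "\<forall>i. \<exists>k. c $ i = emb k * b"
    using B by (auto simp: L.span_singleton ext_scale_def)
  then obtain k where "\<And>i. c $ i = emb (k i) * b" by metis
  then have "c = b *s emb_vec (\<chi> i. k i)" by (simp add: vec_eq_iff emb_vec_def mult.commute)
  then show ?thesis using that by blast
qed

lemma rank_wt_emb_vec:
  assumes "w \<noteq> 0"
  shows "rank_wt emb (emb_vec w :: 'l ^ 'n) = 1"
proof -
  interpret L: vector_space "ext_scale emb" by (rule vector_space_ext_scale)
  \<comment> \<open>All entries are K-multiples of 1.\<close>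
  have "L.dim (range (\<lambda>i. (emb_vec w :: 'l ^ 'n) $ i)) \<le> card {1::'l}"
    by (intro L.dim_le_card) (auto simp: L.span_singleton ext_scale_def emb_vec_def)
  moreover have "rank_wt emb (emb_vec w) \<ge> 1"
    using assms by (intro rank_wt_pos) (simp add: emb_vec_eq_0_iff)
  ultimately show ?thesis by (simp add: rank_wt_def)
qed

lemma M1_eq_1_iff:
  fixes C :: "('l ^ 'n) set"
  assumes C: "vec.subspace C" "C \<noteq> {0}"
  shows "M1 emb C = 1 \<longleftrightarrow> (\<exists>w. w \<noteq> 0 \<and> emb_vec w \<in> C)" and "M1 emb C \<ge> 1"
proof -
  let ?W = "{rank_wt emb c | c. c \<in> C \<and> c \<noteq> 0}"
  \<comment> \<open>The set of weights must be finite and nonempty for \<open>Min\<close> to be an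
    attained value.\<close>
  have "?W \<subseteq> {..CARD('n)}" using rank_wt_le_card by auto
  then have fin: "finite ?W" by (rule finite_subset) simp
  have ne: "?W \<noteq> {}" using C vec.subspace_0 by blast
  have ge: "\<forall>x\<in>?W. x \<ge> 1" using rank_wt_pos by auto
  show M: "M1 emb C \<ge> 1" using fin ne ge by (auto simp: M1_def)
  show "M1 emb C = 1 \<longleftrightarrow> (\<exists>w. w \<noteq> 0 \<and> emb_vec w \<in> C)"
  proof
    assume "M1 emb C = 1"
    then have "1 \<in> ?W" using Min_in[OF fin ne] by (simp add: M1_def)
    then obtain c where c: "c \<in> C" "c \<noteq> 0" "rank_wt emb c = 1" by auto
    obtain b w where bw: "c = b *s emb_vec w" using c(3) by (rule rank_wt_eq_1D)
    then have nz: "b \<noteq> 0" "w \<noteq> 0" using c by auto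
    \<comment> \<open>An L-subspace allows the scalar \<open>b\<close> to be divided out, which
      leaves a vector of K^n in the code.\<close>
    then have "emb_vec w = inverse b *s c" using bw by simp
    then show "\<exists>w. w \<noteq> 0 \<and> emb_vec w \<in> C" using nz c C vec.subspace_scale by metis
  next
    assume "\<exists>w. w \<noteq> 0 \<and> emb_vec w \<in> C"
    then obtain w where w: "w \<noteq> 0" "emb_vec w \<in> C" by blast
    then have "rank_wt emb (emb_vec w) \<in> ?W" by (auto simp: emb_vec_eq_0_iff)
    then have "1 \<in> ?W" using w by (simp add: rank_wt_emb_vec)
    then have "M1 emb C \<le> 1" using fin by (auto simp: M1_def intro: Min_le)
    then show "M1 emb C = 1" using M by simp
  qed
qed

text \<open>For the zero code \<open>M1\<close> is the minimum of an empty set; the first disjunct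
  settles that case without evaluating it.\<close>

lemma zero_or_M1_ge_2_iff:
  fixes C :: "('l ^ 'n) set"
  assumes C: "vec.subspace C"
  shows "C = {0} \<or> M1 emb C \<ge> 2 \<longleftrightarrow> \<not> (\<exists>w. w \<noteq> 0 \<and> emb_vec w \<in> C)"
proof (cases "C = {0}")
  case False
  then show ?thesis using M1_eq_1_iff[OF C False] by auto
qed (auto simp: emb_vec_eq_0_iff)

end

section \<open>Factorization over the extension field\<close>

text \<open>The quotient of \<open>f\<close> by \<open>d\<close> is not a unit, so it has a prime
  factor, which must be one of the \<open>fs i\<close>. Here \<open>cof i\<close> plays the part of
  f / f_i and is fixed by an equation instead of a division.\<close>

lemma proper_divisor_dvd_cofactor:
  fixes fs :: "nat \<Rightarrow> 'a::field poly"
  assumes fs: "\<And>i. i < s \<Longrightarrow> lead_coeff (fs i) = 1 \<and> irreducible (fs i)"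
    and f: "f = (\<Prod>i<s. fs i ^ ms i)" "\<And>i. i < s \<Longrightarrow> f = fs i * cof i"
    and d: "d dvd f" "\<not> f dvd d"
  shows "\<exists>i<s. d dvd cof i"
proof -
  obtain e where e: "f = d * e" using d by blast
  have f0: "f \<noteq> 0" using fs by (force simp: f(1))
  then have "e \<noteq> 0" using e by auto
  moreover have "\<not> is_unit e"
    using d e by (metis dvd_refl mult_unit_dvd_iff)
  ultimately obtain q where q: "lead_coeff q = 1" "irreducible q" "q dvd e"
    using monic_irreducible_factor_exists by blast
  have pr: "prime_elem q" using q by (simp add: field_poly_irreducible_imp_prime)
  have "q dvd (\<Prod>i<s. fs i ^ ms i)" using q e f(1) by (metis dvd_mult)
  then obtain i where i: "i < s" "q dvd fs i ^ ms i"
    using prime_elem_dvd_prodE[OF pr, of "{..<s}"] by blast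
  then have "q dvd fs i" using pr by (metis prime_elem_dvd_power)
  then have "q = fs i" using monic_dvd_irreducible_eq q fs i by blast
  then obtain e' where "e = fs i * e'" using q by blast
  then have "fs i * cof i = fs i * (d * e')" using e f(2)[OF i(1)] by (simp add: mult_ac)
  moreover have "fs i \<noteq> 0" using fs[OF i(1)] by auto
  ultimately show ?thesis using i by auto
qed

context field_embedding
begin

text \<open>The Bezout identity of \<open>p\<close> and its derivative passes to L[x]. A repeated
  factor would divide both images and hence 1.\<close>

lemma separable_map_poly_squarefree:
  assumes "separable_poly p" "p \<noteq> 0" "irreducible q"
  shows "\<not> q * q dvd map_poly emb p"
proof
  assume "q * q dvd map_poly emb p"
  then obtain r where r: "map_poly emb p = q * q * r" by blast
  obtain a b where ab: "a * p + b * pderiv p = 1"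
    by (rule field_poly_bezout[of p "pderiv p"])
      (use assms(1,2) in \<open>auto simp: separable_poly_def coprime_def\<close>)
  have "map_poly emb a * map_poly emb p + map_poly emb b * pderiv (map_poly emb p)
      = map_poly emb (a * p + b * pderiv p)"
    by (simp add: map_poly_add map_poly_mult map_poly_pderiv)
  then have "map_poly emb a * map_poly emb p + map_poly emb b * pderiv (map_poly emb p) = 1"
    by (simp add: ab)
  moreover have "q dvd map_poly emb p" by (simp add: r mult.assoc)
  moreover have "pderiv (map_poly emb p) = q * (q * pderiv r + 2 * (pderiv q * r))"
    by (simp add: r pderiv_mult algebra_simps)
  then have "q dvd pderiv (map_poly emb p)" by simp
  ultimately have "q dvd 1" by (metis dvd_add dvd_mult)
  then show False using assms(3) by (simp add: irreducible_def)
qed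

text \<open>Coprimality over K is a Bezout identity, which remains valid over L. This separates the
  primes over L that belong to different \<open>fs i\<close>.\<close>

lemma irreducible_map_poly_no_common_factor:
  assumes p: "lead_coeff p = 1" "irreducible p" and p': "lead_coeff p' = 1" "irreducible p'"
    and "p \<noteq> p'" and q: "q dvd map_poly emb p" "q dvd map_poly emb p'"
  shows "is_unit q"
proof -
  have "\<not> p dvd p'" using assms monic_dvd_irreducible_eq by blast
  then obtain a b where "a * p + b * p' = 1"
    using field_poly_irreducible_bezout p by blast
  then have "map_poly emb a * map_poly emb p + map_poly emb b * map_poly emb p' = 1"
    by (simp flip: map_poly_add map_poly_mult)
  then show "is_unit q" using q by (metis dvd_add dvd_mult)
qed

text \<open>The polynomials over K divisible by \<open>g\<close> over L form an ideal with a
  generator \<open>d\<close> that divides \<open>f\<close>. A member outside the multiples of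
  \<open>f\<close> makes \<open>d\<close> a proper divisor, so \<open>d\<close> divides some
  \<open>cof i\<close>; conversely \<open>cof i\<close> itself is such a member.\<close>

lemma dvd_map_poly_nonmultiple_iff:
  fixes fs :: "nat \<Rightarrow> 'k poly"
  assumes fs: "\<And>i. i < s \<Longrightarrow> lead_coeff (fs i) = 1 \<and> irreducible (fs i)"
    and f: "f = (\<Prod>i<s. fs i ^ ms i)" "\<And>i. i < s \<Longrightarrow> f = fs i * cof i"
    and g: "g dvd map_poly emb f"
  shows "(\<exists>h. g dvd map_poly emb h \<and> \<not> f dvd h) \<longleftrightarrow> (\<exists>i<s. g dvd map_poly emb (cof i))"
proof
  have f0: "f \<noteq> 0" using fs by (force simp: f(1))
  let ?J = "{h. g dvd map_poly emb h}"
  obtain d where d: "?J = {h. d dvd h}"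
    by (rule field_poly_ideal_principal[of ?J])
      (use f0 g in \<open>auto simp: map_poly_add map_poly_mult\<close>)
  have J: "g dvd map_poly emb h \<longleftrightarrow> d dvd h" for h using d by (simp add: set_eq_iff)
  assume "\<exists>h. g dvd map_poly emb h \<and> \<not> f dvd h"
  then obtain h where h: "d dvd h" "\<not> f dvd h" using J by blast
  then have "\<not> f dvd d" using dvd_trans by blast
  moreover have "d dvd f" using g J by simp
  ultimately show "\<exists>i<s. g dvd map_poly emb (cof i)"
    using proper_divisor_dvd_cofactor[OF fs f] J by blast
next
  assume "\<exists>i<s. g dvd map_poly emb (cof i)"
  then obtain i where i: "i < s" "g dvd map_poly emb (cof i)" by blast
  have f0: "f \<noteq> 0" using fs by (force simp: f(1))
  have "\<not> f dvd cof i"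
  proof
    assume "f dvd cof i"
    then have "fs i * cof i dvd 1 * cof i" using f(2)[OF i(1)] by simp
    moreover have "cof i \<noteq> 0" using f0 f(2)[OF i(1)] by auto
    ultimately have "is_unit (fs i)" using dvd_times_right_cancel_iff by blast
    then show False using fs[OF i(1)] by (simp add: irreducible_def)
  qed
  then show "\<exists>h. g dvd map_poly emb h \<and> \<not> f dvd h" using i by blast
qed

definition lfactors :: "'k poly \<Rightarrow> 'l poly set" where
  "lfactors p = {q. lead_coeff q = 1 \<and> irreducible q \<and> q dvd map_poly emb p}"

lemma card_lfactors: "card (lfactors p) = delta (map_poly emb p)"
  by (simp add: lfactors_def delta_def)

lemma lfactorsD:
  assumes "q \<in> lfactors p"
  shows "lead_coeff q = 1" "irreducible q" "q dvd map_poly emb p" "q \<noteq> 0" "degree q \<ge> 1"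
  using assms by (auto simp: lfactors_def is_unit_iff_degree irreducible_def Suc_le_eq)

section \<open>Factors over L of one monic irreducible separable polynomial\<close>

context
  fixes p :: "'k poly"
  assumes p: "lead_coeff p = 1" "irreducible p" "separable_poly p"
begin

lemma finite_lfactors: "finite (lfactors p)"
  and map_poly_eq_prod_lfactors: "map_poly emb p = \<Prod>(lfactors p)"
proof -
  have "p \<noteq> 0" using p by auto
  then have "\<And>q. irreducible q \<Longrightarrow> \<not> q * q dvd map_poly emb p"
    using separable_map_poly_squarefree p by blast
  moreover have "lead_coeff (map_poly emb p) = 1" using p by (simp add: coeff_map_poly)
  ultimately show "finite (lfactors p)" "map_poly emb p = \<Prod>(lfactors p)"
    unfolding lfactors_def using squarefree_monic_eq_prod by blast+
qed

lemma degree_eq_sum_lfactors: "degree p = (\<Sum>q\<in>lfactors p. degree q)"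
proof -
  have "degree p = degree (\<Prod>(lfactors p))" by (simp flip: map_poly_eq_prod_lfactors)
  also have "\<dots> = (\<Sum>q\<in>lfactors p. degree q)"
    using lfactorsD(4) by (intro degree_prod_eq_sum_degree) blast
  finally show ?thesis .
qed

lemma delta_le_degree: "delta (map_poly emb p) \<le> degree p"
  using sum_mono[of "lfactors p" "\<lambda>_. 1" degree] lfactorsD(5)
  by (simp add: degree_eq_sum_lfactors flip: card_lfactors)

text \<open>The degree is the sum of the degrees of the factors, each at least 1; it equals their
  number only if every term is 1.\<close>

lemma delta_eq_degree_iff:
  "delta (map_poly emb p) = degree p \<longleftrightarrow> (\<forall>q\<in>lfactors p. degree q = 1)"
proof
  assume "delta (map_poly emb p) = degree p"
  then have "(\<Sum>q\<in>lfactors p. 1) = (\<Sum>q\<in>lfactors p. degree q)"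
    by (simp add: degree_eq_sum_lfactors flip: card_lfactors)
  then show "\<forall>q\<in>lfactors p. degree q = 1"
    using finite_lfactors lfactorsD(5) sum_mono_inv[of "\<lambda>_. 1" "lfactors p" degree] by metis
qed (simp add: degree_eq_sum_lfactors flip: card_lfactors)

lemma delta_pos: "delta (map_poly emb p) \<ge> 1"
proof -
  have "lfactors p \<noteq> {}"
  proof
    assume "lfactors p = {}"
    then have "degree p = 0" by (simp add: degree_eq_sum_lfactors)
    then show False using p by (auto simp: is_unit_iff_degree irreducible_def)
  qed
  then show ?thesis using finite_lfactors by (simp add: Suc_le_eq card_gt_0_iff flip: card_lfactors)
qed

text \<open>The polynomial is the product of its monic prime factors, so a single factor is the
  polynomial itself.\<close>

lemma delta_eq_1_iff: "delta (map_poly emb p) = 1 \<longleftrightarrow> irreducible (map_poly emb p)"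
proof
  assume "delta (map_poly emb p) = 1"
  then obtain q where q: "lfactors p = {q}" by (auto simp: card_1_singleton_iff simp flip: card_lfactors)
  then have "map_poly emb p = q" using map_poly_eq_prod_lfactors by simp
  then show "irreducible (map_poly emb p)" using lfactorsD(2) q by blast
next
  assume irr: "irreducible (map_poly emb p)"
  have lc: "lead_coeff (map_poly emb p) = 1" using p by (simp add: coeff_map_poly)
  have "lfactors p = {map_poly emb p}"
  proof
    show "lfactors p \<subseteq> {map_poly emb p}"
      using monic_dvd_irreducible_eq[OF _ lc _ irr] by (auto dest: lfactorsD)
    show "{map_poly emb p} \<subseteq> lfactors p"
      using lc irr by (simp add: lfactors_def)
  qed
  then show "delta (map_poly emb p) = 1" by (simp flip: card_lfactors)
qed

end

section \<open>All the factors f_1, ..., f_s together: exponents over L, counting and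
  splitting\<close>

context
  fixes fs :: "nat \<Rightarrow> 'k poly" and s :: nat
  assumes fs: "\<And>i. i < s \<Longrightarrow> lead_coeff (fs i) = 1 \<and> irreducible (fs i) \<and> separable_poly (fs i)"
    and fs_inj: "inj_on fs {..<s}"
begin

lemma disjoint_lfactors: "disjoint_family_on (\<lambda>i. lfactors (fs i)) {..<s}"
proof (unfold disjoint_family_on_def, intro ballI impI equals0I)
  fix i j q assume ij: "i \<in> {..<s}" "j \<in> {..<s}" "i \<noteq> j"
    and q: "q \<in> lfactors (fs i) \<inter> lfactors (fs j)"
  have "fs i \<noteq> fs j" using ij fs_inj by (auto dest: inj_onD)
  then have "is_unit q"
    using irreducible_map_poly_no_common_factor[of "fs i" "fs j" q] ij fs q lfactorsD(3) by auto
  then show False using lfactorsD(2) q by (auto simp: irreducible_def)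
qed

text \<open>Disjointness of the factor sets makes this meaningful on their union. It turns exponents
  indexed by \<open>i\<close> into exponents attached to primes over L.\<close>

definition idx :: "'l poly \<Rightarrow> nat" where
  "idx q = (THE i. i < s \<and> q \<in> lfactors (fs i))"

lemma idx_eq: "i < s \<Longrightarrow> q \<in> lfactors (fs i) \<Longrightarrow> idx q = i"
  unfolding idx_def using disjoint_lfactors
  by (intro the_equality) (auto simp: disjoint_family_on_def)

text \<open>The exponents are arbitrary because the formula is needed for f and for each quotient f
  / f_i.\<close>

lemma map_poly_prod_power_eq:
  "map_poly emb (\<Prod>i<s. fs i ^ k i) = (\<Prod>q\<in>(\<Union>i<s. lfactors (fs i)). q ^ k (idx q))"
proof -
  have "map_poly emb (\<Prod>i<s. fs i ^ k i) = (\<Prod>i<s. \<Prod>q\<in>lfactors (fs i). q ^ k i)"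
    using map_poly_eq_prod_lfactors fs
    by (simp add: map_poly_prod map_poly_power prod_power_distrib)
  also have "\<dots> = (\<Prod>i<s. \<Prod>q\<in>lfactors (fs i). q ^ k (idx q))"
    by (intro prod.cong refl) (simp add: idx_eq)
  also have "\<dots> = (\<Prod>q\<in>(\<Union>i<s. lfactors (fs i)). q ^ k (idx q))"
    using disjoint_lfactors fs finite_lfactors
    by (subst prod.UNION_disjoint) (auto simp: disjoint_family_on_def)
  finally show ?thesis .
qed

lemma card_monic_divisors:
  fixes f :: "'k poly"
  assumes f: "f = (\<Prod>i<s. fs i ^ ms i)" and ms: "\<And>i. i < s \<Longrightarrow> ms i \<ge> 1"
  shows "card {g. lead_coeff g = 1 \<and> g dvd map_poly emb f}
      = (\<Prod>i<s. (ms i + 1) ^ delta (map_poly emb (fs i)))"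
    and "card {g. lead_coeff g = 1 \<and> g dvd map_poly emb f \<and> \<not> (\<exists>h. g dvd map_poly emb h \<and> \<not> f dvd h)}
      = (\<Prod>i<s. (ms i + 1) ^ delta (map_poly emb (fs i)) - ms i ^ delta (map_poly emb (fs i)))"
proof -
  let ?S = "\<lambda>i. lfactors (fs i)" and ?T = "\<Union>i<s. lfactors (fs i)"
  let ?E = "PiE ?T (\<lambda>q. {..ms (idx q)})" and ?h = "\<lambda>e. \<Prod>q\<in>?T. q ^ e q"
  let ?D = "{g. lead_coeff g = 1 \<and> g dvd map_poly emb f}"
  let ?Q = "\<lambda>g. \<not> (\<exists>h. g dvd map_poly emb h \<and> \<not> f dvd h)"
  have finS: "\<And>i. i < s \<Longrightarrow> finite (?S i)" using fs finite_lfactors by blast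
  then have finT: "finite ?T" by auto
  have T: "\<And>q. q \<in> ?T \<Longrightarrow> lead_coeff q = 1 \<and> irreducible q" using lfactorsD by blast
  have bij: "bij_betw ?h ?E ?D"
    using bij_betw_monic_divisors[OF finT T, of "\<lambda>q. ms (idx q)"] map_poly_prod_power_eq[of ms] f by simp
  have PiE_S: "PiE (?S i) (\<lambda>q. {..ms (idx q)}) = PiE (?S i) (\<lambda>_. {..ms i})" if "i < s" for i
    using that by (intro PiE_cong) (simp add: idx_eq)

  \<comment> \<open>The trivial condition brings the total count into the shape of
    \<open>card_PiE_UN_factorwise\<close>.\<close>
  have "card ?D = card {e \<in> ?E. \<forall>i\<in>{..<s}. True}"
    using bij_betw_same_card[OF bij] by simp
  also have "\<dots> = (\<Prod>i<s. card {e \<in> PiE (?S i) (\<lambda>q. {..ms (idx q)}). True})"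
    by (rule card_PiE_UN_factorwise[OF _ disjoint_lfactors, where P = "\<lambda>_ _. True"]) simp
  also have "\<dots> = (\<Prod>i<s. (ms i + 1) ^ delta (map_poly emb (fs i)))"
    using finS by (intro prod.cong refl) (simp add: PiE_S card_PiE card_lfactors)
  finally show "card ?D = (\<Prod>i<s. (ms i + 1) ^ delta (map_poly emb (fs i)))" .

  \<comment> \<open>\<open>k i\<close> holds the exponents of f / f_i; the subtraction is exact
    because \<open>ms i\<close> is positive.\<close>
  define k where "k i j = (if j = i then ms j - 1 else ms j)" for i j
  define cof where "cof i = (\<Prod>j<s. fs j ^ k i j)" for i
  have cof: "f = fs i * cof i" if "i < s" for i
  proof -
    have "(\<Prod>j\<in>{..<s} - {i}. fs j ^ k i j) = (\<Prod>j\<in>{..<s} - {i}. fs j ^ ms j)"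
      by (intro prod.cong) (auto simp: k_def)
    moreover have "fs i * fs i ^ (ms i - 1) = fs i ^ ms i"
      using ms[OF that] by (cases "ms i") auto
    ultimately show ?thesis
      using that by (simp add: f cof_def prod.remove[of "{..<s}" i] k_def flip: mult.assoc)
  qed
  \<comment> \<open>\<open>restrict\<close> expresses the condition on block \<open>i\<close> as one
    on the restricted function, as the blockwise count requires.\<close>
  have Q: "?Q (?h e) \<longleftrightarrow> (\<forall>i\<in>{..<s}. \<exists>q\<in>?S i. restrict e (?S i) q = ms i)" if e: "e \<in> ?E" for e
  proof -
    have "?h e dvd map_poly emb f" using bij e by (auto simp: bij_betw_def)
    then have "?Q (?h e) \<longleftrightarrow> (\<forall>i<s. \<not> ?h e dvd map_poly emb (cof i))"
      using dvd_map_poly_nonmultiple_iff[of s fs f ms cof "?h e"] fs f cof by blast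
    also have "\<dots> \<longleftrightarrow> (\<forall>i<s. \<exists>q\<in>?S i. e q = ms i)"
    proof -
      have "?h e dvd map_poly emb (cof i) \<longleftrightarrow> (\<forall>q\<in>?S i. e q \<noteq> ms i)" if i: "i < s" for i
      proof -
        have le: "e q \<le> ms j" if "j < s" "q \<in> ?S j" for j q
          using e idx_eq[OF that] that by (auto simp: PiE_iff)
        have "?h e dvd map_poly emb (cof i) \<longleftrightarrow> (\<forall>q\<in>?T. e q \<le> k i (idx q))"
          unfolding cof_def map_poly_prod_power_eq by (rule prod_power_dvd_iff[OF finT T])
        also have "\<dots> \<longleftrightarrow> (\<forall>j<s. \<forall>q\<in>?S j. e q \<le> k i j)"
          using idx_eq by auto
        \<comment> \<open>Outside block \<open>i\<close> the bounds already hold for every member of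
          \<open>?E\<close>; inside it the bound is one below the maximum, so it only excludes the
          value \<open>ms i\<close>.\<close>
        also have "\<dots> \<longleftrightarrow> (\<forall>q\<in>?S i. e q \<le> ms i - 1)"
          using i le by (auto simp: k_def)
        also have "\<dots> \<longleftrightarrow> (\<forall>q\<in>?S i. e q \<noteq> ms i)"
          using le[OF i] ms[OF i] by (intro ball_cong refl) (force simp: le_eq_less_or_eq)
        finally show ?thesis .
      qed
      then show ?thesis by auto
    qed
    finally show ?thesis by auto
  qed
  have "card {g \<in> ?D. ?Q g} = card {e \<in> ?E. ?Q (?h e)}"
  proof -
    have "{g \<in> ?D. ?Q g} = ?h ` {e \<in> ?E. ?Q (?h e)}"
      using bij by (auto simp: bij_betw_def)
    moreover have "inj_on ?h {e \<in> ?E. ?Q (?h e)}"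
      using bij by (auto simp: bij_betw_def intro: inj_on_subset)
    ultimately show ?thesis by (simp add: card_image)
  qed
  also have "{e \<in> ?E. ?Q (?h e)} = {e \<in> ?E. \<forall>i\<in>{..<s}. \<exists>q\<in>?S i. restrict e (?S i) q = ms i}"
    using Q by blast
  also have "card \<dots> = (\<Prod>i<s. card {e \<in> PiE (?S i) (\<lambda>q. {..ms (idx q)}). \<exists>q\<in>?S i. e q = ms i})"
    by (rule card_PiE_UN_factorwise[OF _ disjoint_lfactors]) simp
  also have "\<dots> = (\<Prod>i<s. (ms i + 1) ^ delta (map_poly emb (fs i)) - ms i ^ delta (map_poly emb (fs i)))"
    using card_PiE_attaining_max[OF finS] by (intro prod.cong refl) (simp add: PiE_S card_lfactors)
  finally show "card {g. lead_coeff g = 1 \<and> g dvd map_poly emb f \<and> ?Q g}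
      = (\<Prod>i<s. (ms i + 1) ^ delta (map_poly emb (fs i)) - ms i ^ delta (map_poly emb (fs i)))"
    by (simp add: conj_assoc)
qed

text \<open>If \<open>f\<close> splits, each prime over L dividing some \<open>fs i\<close> divides
  a linear factor and is itself linear. Conversely the image of \<open>f\<close> is a product of
  linear primes, and products of split polynomials split.\<close>

lemma splits_map_poly_iff:
  assumes f: "f = (\<Prod>i<s. fs i ^ ms i)" and ms: "\<And>i. i < s \<Longrightarrow> ms i \<ge> 1"
  shows "splits (map_poly emb f) \<longleftrightarrow> (\<forall>i<s. delta (map_poly emb (fs i)) = degree (fs i))"
proof
  assume "splits (map_poly emb f)"
  then obtain c rs where sp: "map_poly emb f = smult c (prod_list (map (\<lambda>r. [:- r, 1:]) rs))"
    unfolding splits_def by blast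
  have f0: "map_poly emb f \<noteq> 0"
  proof -
    have "lead_coeff f = 1" using fs by (simp add: f lead_coeff_prod lead_coeff_power)
    then have "f \<noteq> 0" by auto
    then show ?thesis by (simp add: map_poly_eq_0_iff)
  qed
  have lin: "degree q = 1" if q: "i < s" "q \<in> lfactors (fs i)" for i q
  proof -
    have pr: "prime_elem q" using lfactorsD(2)[OF q(2)] by (rule field_poly_irreducible_imp_prime)
    have "fs i dvd fs i ^ ms i" using ms[OF q(1)] by (simp add: dvd_power)
    also have "\<dots> dvd f" unfolding f using q by (intro dvd_prodI) auto
    finally have "q dvd map_poly emb f" using lfactorsD(3)[OF q(2)] map_poly_dvd dvd_trans by blast
    moreover have "c \<noteq> 0" using sp f0 by auto
    ultimately have dvd: "q dvd prod_list (map (\<lambda>r. [:- r, 1:]) rs)"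
      by (simp add: sp dvd_smult_iff)
    have "\<exists>r. q dvd [:- r, 1:]"
      using dvd
    proof (induction rs)
      case Nil
      then show ?case using pr by (simp add: prime_elem_not_unit)
    next
      case (Cons r rs)
      then show ?case using prime_elem_dvd_multD[OF pr] by (metis list.simps(9) prod_list.Cons)
    qed
    then obtain r where "q dvd [:- r, 1:]" by blast
    then have "degree q \<le> 1" using dvd_imp_degree_le[of q "[:- r, 1:]"] by simp
    then show ?thesis using lfactorsD(5)[OF q(2)] by simp
  qed
  then show "\<forall>i<s. delta (map_poly emb (fs i)) = degree (fs i)"
    using fs delta_eq_degree_iff by blast
next
  assume del: "\<forall>i<s. delta (map_poly emb (fs i)) = degree (fs i)"
  have sp1: "splits q" if q: "degree q = 1" "lead_coeff q = 1" for q :: "'l poly"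
  proof -
    have "q = [:coeff q 0, 1:]"
    proof (rule poly_eqI)
      fix i
      consider "i = 0" | "i = 1" | "i > degree q" using q(1) by linarith
      then show "coeff q i = coeff [:coeff q 0, 1:] i"
        using q by cases (auto simp: coeff_eq_0 coeff_pCons split: nat.split)
    qed
    \<comment> \<open>The list records roots, so its entry is minus the constant
      coefficient.\<close>
    then have "q = smult 1 (prod_list (map (\<lambda>r. [:- r, 1:]) [- coeff q 0]))" by simp
    then show ?thesis unfolding splits_def by blast
  qed
  have sp_mult: "splits (p * q)" if pq: "splits p" "splits q" for p q :: "'l poly"
  proof -
    obtain c rs d ss where "p = smult c (prod_list (map (\<lambda>r. [:- r, 1:]) rs))"
      "q = smult d (prod_list (map (\<lambda>r. [:- r, 1:]) ss))" using pq unfolding splits_def by blast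
    then have "p * q = smult (c * d) (prod_list (map (\<lambda>r. [:- r, 1:]) (rs @ ss)))" by (simp add: mult_ac)
    then show ?thesis unfolding splits_def by blast
  qed
  have sp_1: "splits (1 :: 'l poly)"
    unfolding splits_def by (intro exI[of _ 1] exI[of _ "[]"]) simp
  have sp_pow: "splits (p ^ k)" if "splits p" for p :: "'l poly" and k
    using that by (induction k) (auto intro: sp_mult sp_1)
  have sp_prod: "splits (prod g A)" if "\<And>x. x \<in> A \<Longrightarrow> splits (g x)" for g :: "'l poly \<Rightarrow> 'l poly" and A
    using that by (induction A rule: infinite_finite_induct) (auto intro: sp_mult sp_1)
  have "splits q" if "i < s" "q \<in> lfactors (fs i)" for i q
    using that del fs delta_eq_degree_iff lfactorsD(1) by (intro sp1) blast+
  then show "splits (map_poly emb f)"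
    unfolding f map_poly_prod_power_eq by (intro sp_prod sp_pow) blast
qed

end

end

section \<open>The single factor of the proportion as a function of the exponent\<close>

lemma prob_factor_eq:
  "real ((m + 1) ^ k - m ^ k) / real ((m + 1) ^ k) = 1 - (real m / real (m + 1)) ^ k"
proof -
  \<comment> \<open>This makes the subtraction of naturals exact, so that it agrees with the real
    one.\<close>
  have "m ^ k \<le> (m + 1) ^ k" by (intro power_mono) auto
  then show ?thesis by (simp add: of_nat_diff diff_divide_distrib power_divide del: of_nat_add of_nat_Suc)
qed

text \<open>The base lies strictly between 0 and 1. Positivity of \<open>m\<close> excludes the base
  0, for which all positive exponents would give the same value.\<close>

lemma prob_factor_less:
  assumes "m \<ge> (1::nat)" "j < k"
  shows "1 - (real m / real (m + 1)) ^ j < 1 - (real m / real (m + 1)) ^ k"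
  using assms by (simp add: power_strict_decreasing)

section \<open>The proportion of codes\<close>

theorem theorem4:
  fixes emb :: "'k::field \<Rightarrow> 'l::field"
    and d :: nat
    and M :: "'k ^ 'n ^ 'n"
    and s :: nat
    and fs :: "nat \<Rightarrow> 'k poly"
    and ms :: "nat \<Rightarrow> nat"
    and f :: "'k poly"
  assumes ext: "is_field_ext emb"
    and deg: "ext_degree_is emb d"
    and dn: "d \<ge> CARD('n)"
    and cyc: "cyclic_matrix M"
    and minp: "is_min_poly M f"
    and fprod: "f = (\<Prod>i<s. fs i ^ ms i)"
    and fs_monic: "\<forall>i<s. lead_coeff (fs i) = 1"
    and fs_irr: "\<forall>i<s. irreducible (fs i)"
    and fs_sep: "\<forall>i<s. separable_poly (fs i)"
    and fs_dist: "inj_on fs {..<s}"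
    and ms_pos: "\<forall>i<s. ms i \<ge> 1"
  defines "Prop \<equiv> real (card {C \<in> cyclic_codes emb M. C = {0} \<or> M1 emb C \<ge> 2})
                   / real (card (cyclic_codes emb M))"
  shows "Prop = (\<Prod>i<s. 1 - (real (ms i) / real (ms i + 1)) ^ delta (map_poly emb (fs i)))
    \<and> (\<Prod>i<s. 1 / real (ms i + 1)) \<le> Prop
    \<and> Prop \<le> (\<Prod>i<s. 1 - (real (ms i) / real (ms i + 1)) ^ degree (fs i))
    \<and> (Prop = (\<Prod>i<s. 1 / real (ms i + 1)) \<longleftrightarrow> (\<forall>i<s. irreducible (map_poly emb (fs i))))
    \<and> ((\<forall>i<s. irreducible (map_poly emb (fs i))) \<longleftrightarrow>
         (\<forall>C\<in>cyclic_codes emb M. C \<noteq> {0} \<longrightarrow> M1 emb C = 1))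
    \<and> (Prop = (\<Prod>i<s. 1 - (real (ms i) / real (ms i + 1)) ^ degree (fs i))
         \<longleftrightarrow> splits (map_poly emb f))"
proof -
  interpret field_embedding emb by unfold_locales (rule ext)
  define \<delta> where "\<delta> i = delta (map_poly emb (fs i))" for i
  define r where "r i = real (ms i) / real (ms i + 1)" for i
  define bad where "bad = {C \<in> cyclic_codes emb M. C = {0} \<or> M1 emb C \<ge> 2}"
  have fs: "\<And>i. i < s \<Longrightarrow> lead_coeff (fs i) = 1 \<and> irreducible (fs i) \<and> separable_poly (fs i)"
    using fs_monic fs_irr fs_sep by blast
  have ms: "\<And>i. i < s \<Longrightarrow> ms i \<ge> 1" using ms_pos by blast
  have f1: "lead_coeff f = 1" using minp by (simp add: is_min_poly_def)
  obtain v where v: "surj (poly_act M v)" "\<And>p. poly_act M v p = 0 \<longleftrightarrow> f dvd p" "degree f = CARD('n)"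
    using cyclic_matrix_min_poly[OF cyc minp] by blast
  define code where "code g = poly_act (map_mat emb M) (emb_vec v) ` {p. g dvd p}" for g
  let ?D = "{g. lead_coeff g = 1 \<and> g dvd map_poly emb f}"
  let ?Q = "\<lambda>g. \<not> (\<exists>h. g dvd map_poly emb h \<and> \<not> f dvd h)"
  note codes = bij_betw_monic_divisors_cyclic_codes[OF v(1,2) f1 v(3), folded code_def]
  have bij: "bij_betw code ?D (cyclic_codes emb M)" by (rule codes(1))
  have total: "card (cyclic_codes emb M) = (\<Prod>i<s. (ms i + 1) ^ \<delta> i)"
    using bij_betw_same_card[OF bij] card_monic_divisors(1)[OF fs fs_dist fprod ms] by (simp add: \<delta>_def)
  \<comment> \<open>The rank-metric condition becomes the absence of nonzero vectors of K^n, which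
    the divisor of a code can detect.\<close>
  have bad_iff: "C \<in> bad \<longleftrightarrow> \<not> (\<exists>w. w \<noteq> 0 \<and> emb_vec w \<in> C)" if "C \<in> cyclic_codes emb M" for C
    using that zero_or_M1_ge_2_iff[of C] by (auto simp: bad_def cyclic_codes_def)
  have bad_code: "code g \<in> bad \<longleftrightarrow> ?Q g" if "g \<in> ?D" for g
  proof -
    have g: "g dvd map_poly emb f" "code g \<in> cyclic_codes emb M"
      using that bij_betwE[OF bij] by simp_all
    show ?thesis unfolding bad_iff[OF g(2)] codes(2)[OF g(1)] by (rule refl)
  qed
  have card_bad: "card bad = (\<Prod>i<s. (ms i + 1) ^ \<delta> i - ms i ^ \<delta> i)"
  proof -
    have "bad = code ` {g \<in> ?D. ?Q g}"
    proof
      show "bad \<subseteq> code ` {g \<in> ?D. ?Q g}"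
      proof
        fix C assume C: "C \<in> bad"
        then have "C \<in> code ` ?D" using bij by (simp add: bad_def bij_betw_def)
        then obtain g where "g \<in> ?D" "C = code g" by blast
        then show "C \<in> code ` {g \<in> ?D. ?Q g}" using bad_code C by blast
      qed
      show "code ` {g \<in> ?D. ?Q g} \<subseteq> bad" using bad_code by blast
    qed
    moreover have "inj_on code {g \<in> ?D. ?Q g}"
      using bij by (auto simp: bij_betw_def intro: inj_on_subset)
    ultimately have "card bad = card {g \<in> ?D. ?Q g}" by (simp add: card_image)
    then show ?thesis
      using card_monic_divisors(2)[OF fs fs_dist fprod ms] by (simp add: \<delta>_def conj_assoc)
  qed
  have \<delta>_pos: "\<delta> i \<ge> 1" and \<delta>_le: "\<delta> i \<le> degree (fs i)"
    and \<delta>_1: "\<delta> i = 1 \<longleftrightarrow> irreducible (map_poly emb (fs i))" if "i < s" for i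
    using that fs[OF that] delta_pos[of "fs i"] delta_le_degree[of "fs i"] delta_eq_1_iff[of "fs i"]
    by (auto simp: \<delta>_def)
  have Prop: "Prop = (\<Prod>i<s. 1 - r i ^ \<delta> i)"
  proof -
    have "Prop = real (\<Prod>i<s. (ms i + 1) ^ \<delta> i - ms i ^ \<delta> i) / real (\<Prod>i<s. (ms i + 1) ^ \<delta> i)"
      using card_bad total by (simp only: Prop_def bad_def)
    also have "\<dots> = (\<Prod>i<s. real ((ms i + 1) ^ \<delta> i - ms i ^ \<delta> i) / real ((ms i + 1) ^ \<delta> i))"
      by (simp only: of_nat_prod prod_dividef)
    also have "\<dots> = (\<Prod>i<s. 1 - r i ^ \<delta> i)"
      by (simp only: prob_factor_eq r_def)
    finally show ?thesis .
  qed
  have less: "1 - r i ^ j < 1 - r i ^ k" if "i < s" "j < k" for i j k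
    unfolding r_def using ms that by (intro prob_factor_less) auto
  have le: "1 - r i ^ j \<le> 1 - r i ^ k" and eq: "1 - r i ^ j = 1 - r i ^ k \<longleftrightarrow> j = k"
    if "i < s" "j \<le> k" for i j k
    using less[OF that(1), of j k] that(2) by (cases "j = k"; simp)+
  \<comment> \<open>Comparison with the exponent 0, where the expression vanishes.\<close>
  have pos: "0 < 1 - r i ^ k" if "i < s" "k \<ge> 1" for i k
    using less[OF that(1), of 0 k] that(2) by simp
  \<comment> \<open>The lower bound is the case of exponent 1, so both bounds reduce to comparing
    the exponents 1, \<open>\<delta> i\<close> and \<open>degree (fs i)\<close>.\<close>
  have low: "(\<Prod>i<s. 1 / real (ms i + 1)) = (\<Prod>i<s. 1 - r i ^ 1)"
    by (intro prod.cong) (simp_all add: r_def field_simps)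
  have irr_iff: "(\<forall>i<s. irreducible (map_poly emb (fs i))) \<longleftrightarrow> (\<forall>i<s. \<delta> i = 1)"
    using \<delta>_1 by blast
  have "(\<Prod>i<s. 1 - r i ^ 1) \<le> Prop"
    unfolding Prop using le[OF _ \<delta>_pos] pos[of _ 1] by (intro prod_mono) (auto intro: less_imp_le)
  moreover have "Prop \<le> (\<Prod>i<s. 1 - r i ^ degree (fs i))"
    unfolding Prop using le[OF _ \<delta>_le] pos[OF _ \<delta>_pos] by (intro prod_mono) (auto intro: less_imp_le)
  moreover have "Prop = (\<Prod>i<s. 1 - r i ^ 1) \<longleftrightarrow> (\<forall>i<s. irreducible (map_poly emb (fs i)))"
  proof -
    \<comment> \<open>\<open>prod_eq_iff_of_le\<close> expects the smaller product on the left; the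
      equation is reversed at the end.\<close>
    have "(\<Prod>i<s. 1 - r i ^ 1) = Prop \<longleftrightarrow> (\<forall>i\<in>{..<s}. 1 - r i ^ 1 = 1 - r i ^ \<delta> i)"
      unfolding Prop using le[OF _ \<delta>_pos] pos[of _ 1] by (intro prod_eq_iff_of_le) auto
    also have "\<dots> \<longleftrightarrow> (\<forall>i<s. \<delta> i = 1)"
      using eq[OF _ \<delta>_pos] by fastforce
    finally show ?thesis unfolding irr_iff by (simp only: eq_commute)
  qed
  moreover have "Prop = (\<Prod>i<s. 1 - r i ^ degree (fs i)) \<longleftrightarrow> splits (map_poly emb f)"
  proof -
    have "Prop = (\<Prod>i<s. 1 - r i ^ degree (fs i))
        \<longleftrightarrow> (\<forall>i\<in>{..<s}. 1 - r i ^ \<delta> i = 1 - r i ^ degree (fs i))"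
      unfolding Prop using le[OF _ \<delta>_le] pos[OF _ \<delta>_pos] by (intro prod_eq_iff_of_le) auto
    also have "\<dots> \<longleftrightarrow> (\<forall>i<s. \<delta> i = degree (fs i))"
      using eq[OF _ \<delta>_le] by fastforce
    also have "\<dots> \<longleftrightarrow> splits (map_poly emb f)"
      unfolding \<delta>_def using splits_map_poly_iff[OF fs fs_dist fprod ms] by simp
    finally show ?thesis .
  qed
  moreover have "(\<forall>i<s. irreducible (map_poly emb (fs i))) \<longleftrightarrow>
      (\<forall>C\<in>cyclic_codes emb M. C \<noteq> {0} \<longrightarrow> M1 emb C = 1)"
  proof -
    \<comment> \<open>The zero code always belongs to \<open>bad\<close>, so the statement about all
      nonzero codes says that \<open>bad\<close> has exactly one element.\<close>
    have zero_bad: "{0} \<in> bad"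
      by (simp add: bad_def cyclic_codes_def vec.subspace_0 vec.subspace_single_0)
    have "card (cyclic_codes emb M) > 0" unfolding total by (intro prod_pos) auto
    then have "finite bad" by (simp add: bad_def card_ge_0_finite)
    then have "card bad = 1 \<longleftrightarrow> bad = {{0}}"
      using zero_bad by (auto simp: card_1_singleton_iff)
    also have "\<dots> \<longleftrightarrow> (\<forall>C\<in>bad. C = {0})" using zero_bad by auto
    also have "\<dots> \<longleftrightarrow> (\<forall>C\<in>cyclic_codes emb M. C \<noteq> {0} \<longrightarrow> \<not> M1 emb C \<ge> 2)"
      by (auto simp: bad_def)
    also have "\<dots> \<longleftrightarrow> (\<forall>C\<in>cyclic_codes emb M. C \<noteq> {0} \<longrightarrow> M1 emb C = 1)"
    proof -
      have "\<not> M1 emb C \<ge> 2 \<longleftrightarrow> M1 emb C = 1" if "C \<in> cyclic_codes emb M" "C \<noteq> {0}" for C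
        using M1_eq_1_iff(2)[of C] that by (auto simp: cyclic_codes_def)
      then show ?thesis by blast
    qed
    finally have "(\<forall>C\<in>cyclic_codes emb M. C \<noteq> {0} \<longrightarrow> M1 emb C = 1) \<longleftrightarrow> card bad = 1" by blast
    \<comment> \<open>A product of natural numbers is 1 only if every factor is 1.\<close>
    also have "\<dots> \<longleftrightarrow> (\<forall>i\<in>{..<s}. (ms i + 1) ^ \<delta> i - ms i ^ \<delta> i = 1)"
      unfolding card_bad by (rule prod_eq_1_iff) simp
    also have "\<dots> \<longleftrightarrow> (\<forall>i<s. \<delta> i = 1)"
      using power_diff_eq_1_iff[OF ms \<delta>_pos] by blast
    finally show ?thesis using irr_iff by blast
  qed
  ultimately show ?thesis
    using Prop unfolding low by (simp only: r_def \<delta>_def)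
qed

end
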